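(* Let $V$ be a Komori variety. The theory $\mathbb{L}oc_V^1$ is equivalent to the theory $\mathbb{L}oc_V^2$ (i.e. the two theories prove the same sequents over the signature of MV-algebras).
   Context: An MV-algebra is a structure $(A,\oplus,\neg,0)$ such that $(A,\oplus,0)$ is a commutative monoid, $\neg\neg x=x$, $x\oplus\neg 0=\neg 0$ and $\neg(\neg x\oplus y)\oplus y=\neg(\neg y\oplus x)\oplus x$. Write $1=\neg 0$, $x\odot y=\neg(\neg x\oplus\neg y)$, $d(x,y)=(x\odot\neg y)\oplus(y\odot\neg x)$, $kx=x\oplus\cdots\oplus x$ and $x^k=x\odot\cdots\odot x$ ($k$ times). $\mathbb{MV}$ is the algebraic theory of MV-algebras. For a lattice-ordered abelian group $G$ and $u\ge 0$ in $G$, $\Gamma(G,u)$ is the MV-algebra on $[0,u]$ with $x\oplus y=\inf(x+y,u)$, $\neg x=u-x$. By Mundici's equivalence every MV-algebra is of this form with $u$ a strong unit. For $m\ge 1$, $S_m=\Gamma(\mathbb{Z},m)$ and $S_m^\omega=\Gamma(\mathbb{Z}\times_{\mathrm{lex}}\mathbb{Z},(m,0))$. A Komori variety is a variety $V=V(\{S_i\}_{i\in I},\{S_j^\omega\}_{j\in J})$ generated by these algebras, with $I,J$ finite sets of positive integers, not both empty. Put $n=\mathrm{l.c.m.}(I\cup J)$, which depends only on $V$. $\mathbb{T}_V$ is the algebraic theory axiomatizing $V$: the axioms of $\mathbb{MV}$ plus, with $N=\max(I\cup J)$, the sequents (for all $x$): $((N+1)x^N)^2=2x^{N+1}$; $(px^{p-1})^{N+1}=(N+1)x^p$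 for every $1<p<N$ dividing no element of $I\cup J$; $(N+1)x^q=(N+2)x^q$ for every $q$ which divides some $i\in I$ but no $j\in J$; and $((n+1)x^n)^2=2x^{n+1}$. Formulae $x\in\mathrm{Fin}_d^n$ ($0\le d\le n$). $x\in\mathrm{Fin}_0^n$ means $((n+1)x)^2=0$. For $1\le d\le n$ let $D=\gcd(d,n)$ and let $\xi,\chi$ be the unique natural numbers with $0\le\xi\le n/D$, $0\le\chi\le d/D$, $D=\xi d-\chi n$. Let $D_{d,n}^x$ be the MV-term in $x$ whose value in $\Gamma(G,u)$ is $\inf(u,\sup(0,\xi x-\chi u))$, computed in $G$; equivalently it is the $(\chi+1)$-th component of the sum of $\xi$ copies of the sequence $(x,0,0,\dots)$, where the sum $c$ of sequences $a,b$ is given by $c_i=a_i\oplus(a_{i-1}\odot b_1)\oplus\cdots\oplus(a_1\odot b_{i-1})\oplus b_i$. Write $z\equiv w$ for $((n+1)d(z,w))^2=0$. Then $x\in\mathrm{Fin}_d^n$ is the formula $(x\equiv\frac{d}{D}D_{d,n}^x)\wedge\bigwedge_{k=0}^{n/D}\big(\neg(kD_{d,n}^x)\equiv(\frac{n}{D}-k)D_{d,n}^x\big)$. $\mathbb{L}oc_V^1$ is obtained from $\mathbb{T}_V$ by adding $\sigma_n:(\top\vdash_x((n+1)x)^2=0\vee(n+1)x=1)$ and $(0=1\vdash\bot)$. $\mathbb{L}oc_V^2$ is obtained from $\mathbb{T}_V$ by adding $\rho_n:(\top\vdash_x\bigvee_{d=0}^n x\in\mathrm{Fin}_d^n)$ and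 $(0=1\vdash\bot)$. Provability is in geometric (coherent) logic. The axiom of choice is assumed. *)

theory Defs
  imports Main "HOL-Library.Lattice_Algebras"
begin

datatype mvterm = Var nat | Zero | Neg mvterm | Oplus mvterm mvterm (infixl "\<oplus>" 65)

definition One :: mvterm where "One = Neg Zero"

definition Odot :: "mvterm \<Rightarrow> mvterm \<Rightarrow> mvterm" (infixl "\<odot>" 70) where
  "s \<odot> t = Neg (Neg s \<oplus> Neg t)"

definition tdist :: "mvterm \<Rightarrow> mvterm \<Rightarrow> mvterm" where
  "tdist s t = (s \<odot> Neg t) \<oplus> (t \<odot> Neg s)"

primrec tmul :: "nat \<Rightarrow> mvterm \<Rightarrow> mvterm" where
  "tmul 0 t = Zero"
| "tmul (Suc k) t = tmul k t \<oplus> t"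

primrec tpow :: "mvterm \<Rightarrow> nat \<Rightarrow> mvterm" where
  "tpow t 0 = One"
| "tpow t (Suc k) = tpow t k \<odot> t"

primrec is_term :: "nat \<Rightarrow> mvterm \<Rightarrow> bool" where
  "is_term k (Var i) = (i < k)"
| "is_term k Zero = True"
| "is_term k (Neg t) = is_term k t"
| "is_term k (s \<oplus> t) = (is_term k s \<and> is_term k t)"

primrec tsubst :: "(nat \<Rightarrow> mvterm) \<Rightarrow> mvterm \<Rightarrow> mvterm" where
  "tsubst \<sigma> (Var i) = \<sigma> i"
| "tsubst \<sigma> Zero = Zero"
| "tsubst \<sigma> (Neg t) = Neg (tsubst \<sigma> t)"
| "tsubst \<sigma> (s \<oplus> t) = tsubst \<sigma> s \<oplus> tsubst \<sigma> t"

text \<open>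
  Variables are de Bruijn indices: a context is a natural number \<open>k\<close>, standing for the
  variables \<open>Var 0, ..., Var (k - 1)\<close>, and \<open>Ex\<close> binds \<open>Var 0\<close> of its body.
  \<open>DISJ\<close> is the set-indexed disjunction of geometric logic. The index type \<open>'i\<close> is
  arbitrary, and a family over a smaller index set is padded with \<open>Bot\<close>, so a statement
  that is polymorphic in \<open>'i\<close> covers disjunctions over index sets of every size.
\<close>

datatype 'i fm =
    Eq mvterm mvterm
  | Top
  | Bot
  | And "'i fm" "'i fm"
  | Or "'i fm" "'i fm"
  | Ex "'i fm"
  | DISJ "'i \<Rightarrow> 'i fm"

datatype logic = Coherent | Geometric

primrec is_formula :: "logic \<Rightarrow> nat \<Rightarrow> 'i fm \<Rightarrow> bool" where
  "is_formula L k (Eq s t) = (is_term k s \<and> is_term k t)"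
| "is_formula L k Top = True"
| "is_formula L k Bot = True"
| "is_formula L k (And \<phi> \<psi>) = (is_formula L k \<phi> \<and> is_formula L k \<psi>)"
| "is_formula L k (Or \<phi> \<psi>) = (is_formula L k \<phi> \<and> is_formula L k \<psi>)"
| "is_formula L k (Ex \<phi>) = is_formula L (Suc k) \<phi>"
| "is_formula L k (DISJ \<Phi>) = (L = Geometric \<and> (\<forall>i. is_formula L k (\<Phi> i)))"

definition up :: "(nat \<Rightarrow> mvterm) \<Rightarrow> nat \<Rightarrow> mvterm" where
  "up \<sigma> i = (case i of 0 \<Rightarrow> Var 0 | Suc j \<Rightarrow> tsubst (\<lambda>m. Var (Suc m)) (\<sigma> j))"

primrec fsubst :: "(nat \<Rightarrow> mvterm) \<Rightarrow> 'i fm \<Rightarrow> 'i fm" where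
  "fsubst \<sigma> (Eq s t) = Eq (tsubst \<sigma> s) (tsubst \<sigma> t)"
| "fsubst \<sigma> Top = Top"
| "fsubst \<sigma> Bot = Bot"
| "fsubst \<sigma> (And \<phi> \<psi>) = And (fsubst \<sigma> \<phi>) (fsubst \<sigma> \<psi>)"
| "fsubst \<sigma> (Or \<phi> \<psi>) = Or (fsubst \<sigma> \<phi>) (fsubst \<sigma> \<psi>)"
| "fsubst \<sigma> (Ex \<phi>) = Ex (fsubst (up \<sigma>) \<phi>)"
| "fsubst \<sigma> (DISJ \<Phi>) = DISJ (\<lambda>i. fsubst \<sigma> (\<Phi> i))"

definition lift :: "'i fm \<Rightarrow> 'i fm" where
  "lift \<phi> = fsubst (\<lambda>i. Var (Suc i)) \<phi>"

primrec big_or :: "'i fm list \<Rightarrow> 'i fm" where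
  "big_or [] = Bot"
| "big_or (\<phi> # \<phi>s) = Or \<phi> (big_or \<phi>s)"

primrec big_and :: "'i fm list \<Rightarrow> 'i fm" where
  "big_and [] = Top"
| "big_and (\<phi> # \<phi>s) = And \<phi> (big_and \<phi>s)"

datatype 'i sequent =
  Sequent "'i fm" nat "'i fm"  ("(_ \<turnstile>\<^bsub>_\<^esub> _)" [51, 0, 51] 50)

text \<open>
  The sequent calculus of Johnstone, Sketches of an Elephant, D1.3.1. In coherent logic
  no formula in a derivation contains \<open>DISJ\<close>.
\<close>

inductive derivable :: "logic \<Rightarrow> 'i sequent set \<Rightarrow> 'i sequent \<Rightarrow> bool"
  for L :: logic and T :: "'i sequent set" where
  ax: "S \<in> T \<Longrightarrow> derivable L T S"
| identity: "is_formula L k \<phi> \<Longrightarrow> derivable L T (\<phi> \<turnstile>\<^bsub>k\<^esub> \<phi>)"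
| subst: "\<lbrakk>derivable L T (\<phi> \<turnstile>\<^bsub>k\<^esub> \<psi>); \<forall>i<k. is_term m (\<sigma> i)\<rbrakk>
    \<Longrightarrow> derivable L T (fsubst \<sigma> \<phi> \<turnstile>\<^bsub>m\<^esub> fsubst \<sigma> \<psi>)"
| cut: "\<lbrakk>derivable L T (\<phi> \<turnstile>\<^bsub>k\<^esub> \<psi>); derivable L T (\<psi> \<turnstile>\<^bsub>k\<^esub> \<chi>)\<rbrakk>
    \<Longrightarrow> derivable L T (\<phi> \<turnstile>\<^bsub>k\<^esub> \<chi>)"
| eq_refl: "derivable L T (Top \<turnstile>\<^bsub>1\<^esub> Eq (Var 0) (Var 0))"
| eq_replace: "\<lbrakk>i < k; j < k; is_formula L k \<phi>\<rbrakk>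
    \<Longrightarrow> derivable L T (And (Eq (Var i) (Var j)) \<phi> \<turnstile>\<^bsub>k\<^esub> fsubst (Var(i := Var j)) \<phi>)"
| top: "is_formula L k \<phi> \<Longrightarrow> derivable L T (\<phi> \<turnstile>\<^bsub>k\<^esub> Top)"
| and1: "\<lbrakk>is_formula L k \<phi>; is_formula L k \<psi>\<rbrakk> \<Longrightarrow> derivable L T (And \<phi> \<psi> \<turnstile>\<^bsub>k\<^esub> \<phi>)"
| and2: "\<lbrakk>is_formula L k \<phi>; is_formula L k \<psi>\<rbrakk> \<Longrightarrow> derivable L T (And \<phi> \<psi> \<turnstile>\<^bsub>k\<^esub> \<psi>)"
| andI: "\<lbrakk>derivable L T (\<phi> \<turnstile>\<^bsub>k\<^esub> \<psi>); derivable L T (\<phi> \<turnstile>\<^bsub>k\<^esub> \<chi>)\<rbrakk>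
    \<Longrightarrow> derivable L T (\<phi> \<turnstile>\<^bsub>k\<^esub> And \<psi> \<chi>)"
| bot: "is_formula L k \<phi> \<Longrightarrow> derivable L T (Bot \<turnstile>\<^bsub>k\<^esub> \<phi>)"
| or1: "\<lbrakk>is_formula L k \<phi>; is_formula L k \<psi>\<rbrakk> \<Longrightarrow> derivable L T (\<phi> \<turnstile>\<^bsub>k\<^esub> Or \<phi> \<psi>)"
| or2: "\<lbrakk>is_formula L k \<phi>; is_formula L k \<psi>\<rbrakk> \<Longrightarrow> derivable L T (\<psi> \<turnstile>\<^bsub>k\<^esub> Or \<phi> \<psi>)"
| orE: "\<lbrakk>derivable L T (\<phi> \<turnstile>\<^bsub>k\<^esub> \<chi>); derivable L T (\<psi> \<turnstile>\<^bsub>k\<^esub> \<chi>)\<rbrakk>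
    \<Longrightarrow> derivable L T (Or \<phi> \<psi> \<turnstile>\<^bsub>k\<^esub> \<chi>)"
| disjI: "is_formula L k (DISJ \<Phi>) \<Longrightarrow> derivable L T (\<Phi> i \<turnstile>\<^bsub>k\<^esub> DISJ \<Phi>)"
| disjE: "\<lbrakk>is_formula L k (DISJ \<Phi>); \<forall>i. derivable L T (\<Phi> i \<turnstile>\<^bsub>k\<^esub> \<chi>)\<rbrakk>
    \<Longrightarrow> derivable L T (DISJ \<Phi> \<turnstile>\<^bsub>k\<^esub> \<chi>)"
| exE: "\<lbrakk>derivable L T (\<phi> \<turnstile>\<^bsub>Suc k\<^esub> lift \<psi>); is_formula L k \<psi>\<rbrakk>
    \<Longrightarrow> derivable L T (Ex \<phi> \<turnstile>\<^bsub>k\<^esub> \<psi>)"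
| exI: "derivable L T (Ex \<phi> \<turnstile>\<^bsub>k\<^esub> \<psi>) \<Longrightarrow> derivable L T (\<phi> \<turnstile>\<^bsub>Suc k\<^esub> lift \<psi>)"
| distrib: "\<lbrakk>is_formula L k \<phi>; is_formula L k \<psi>; is_formula L k \<chi>\<rbrakk>
    \<Longrightarrow> derivable L T (And \<phi> (Or \<psi> \<chi>) \<turnstile>\<^bsub>k\<^esub> Or (And \<phi> \<psi>) (And \<phi> \<chi>))"
| distrib_disj: "\<lbrakk>is_formula L k \<phi>; is_formula L k (DISJ \<Psi>)\<rbrakk>
    \<Longrightarrow> derivable L T (And \<phi> (DISJ \<Psi>) \<turnstile>\<^bsub>k\<^esub> DISJ (\<lambda>i. And \<phi> (\<Psi> i)))"
| frobenius: "\<lbrakk>is_formula L k \<phi>; is_formula L (Suc k) \<psi>\<rbrakk>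
    \<Longrightarrow> derivable L T (And \<phi> (Ex \<psi>) \<turnstile>\<^bsub>k\<^esub> Ex (And (lift \<phi>) \<psi>))"

text \<open>An identity \<open>(k, s, t)\<close> is the equation \<open>s = t\<close> in the context \<open>k\<close>.\<close>

definition mv_axioms :: "(nat \<times> mvterm \<times> mvterm) set" where
  "mv_axioms =
    (let x = Var 0; y = Var 1; z = Var 2 in
     {(3, (x \<oplus> y) \<oplus> z, x \<oplus> (y \<oplus> z)),
      (2, x \<oplus> y, y \<oplus> x),
      (1, x \<oplus> Zero, x),
      (1, Neg (Neg x), x),
      (1, x \<oplus> Neg Zero, Neg Zero),
      (2, Neg (Neg x \<oplus> y) \<oplus> y, Neg (Neg y \<oplus> x) \<oplus> x)})"

record 'a mv_struct =
  mv_carrier :: "'a set"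
  mv_zero :: 'a
  mv_neg :: "'a \<Rightarrow> 'a"
  mv_plus :: "'a \<Rightarrow> 'a \<Rightarrow> 'a"

primrec mv_eval :: "'a mv_struct \<Rightarrow> (nat \<Rightarrow> 'a) \<Rightarrow> mvterm \<Rightarrow> 'a" where
  "mv_eval A v (Var i) = v i"
| "mv_eval A v Zero = mv_zero A"
| "mv_eval A v (Neg t) = mv_neg A (mv_eval A v t)"
| "mv_eval A v (s \<oplus> t) = mv_plus A (mv_eval A v s) (mv_eval A v t)"

definition mv_satisfies :: "'a mv_struct \<Rightarrow> mvterm \<Rightarrow> mvterm \<Rightarrow> bool" where
  "mv_satisfies A s t \<longleftrightarrow>
    (\<forall>v. range v \<subseteq> mv_carrier A \<longrightarrow> mv_eval A v s = mv_eval A v t)"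

definition mv_algebra :: "'a mv_struct \<Rightarrow> bool" where
  "mv_algebra A \<longleftrightarrow>
    mv_zero A \<in> mv_carrier A \<and>
    (\<forall>x\<in>mv_carrier A. mv_neg A x \<in> mv_carrier A) \<and>
    (\<forall>x\<in>mv_carrier A. \<forall>y\<in>mv_carrier A. mv_plus A x y \<in> mv_carrier A) \<and>
    (\<forall>(k, s, t)\<in>mv_axioms. mv_satisfies A s t)"

definition Gamma :: "'g::lattice_ab_group_add \<Rightarrow> 'g mv_struct" where
  "Gamma u =
    \<lparr>mv_carrier = {0..u}, mv_zero = 0, mv_neg = (\<lambda>x. u - x), mv_plus = (\<lambda>x y. inf (x + y) u)\<rparr>"

text \<open>
  The group \<open>\<int> \<times>\<^sub>l\<^sub>e\<^sub>x \<int>\<close> is a type of its own, since orders on the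
  product type are provided by mutually incompatible library theories.
\<close>

datatype lexint = Lex (lfst: int) (lsnd: int)

instantiation lexint :: ab_group_add
begin
definition "0 = Lex 0 0"
definition "a + b = Lex (lfst a + lfst b) (lsnd a + lsnd b)"
definition "- a = Lex (- lfst a) (- lsnd a)"
definition "a - b = Lex (lfst a - lfst b) (lsnd a - lsnd b)"
instance
  by standard
    (simp_all add: zero_lexint_def plus_lexint_def uminus_lexint_def minus_lexint_def)
end

instantiation lexint :: linorder
begin
definition "a \<le> b \<longleftrightarrow> lfst a < lfst b \<or> lfst a = lfst b \<and> lsnd a \<le> lsnd b"
definition "a < b \<longleftrightarrow> lfst a < lfst b \<or> lfst a = lfst b \<and> lsnd a < lsnd b"
instance
  by standard (auto simp: less_eq_lexint_def less_lexint_def lexint.expand)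
end

instantiation lexint :: lattice_ab_group_add
begin
definition "inf a b = (min a b :: lexint)"
definition "sup a b = (max a b :: lexint)"
instance
proof
  fix a b c :: lexint
  show "a \<le> b \<Longrightarrow> c + a \<le> c + b"
    by (auto simp: less_eq_lexint_def plus_lexint_def)
qed (simp_all add: inf_lexint_def sup_lexint_def)
end

definition S_alg :: "nat \<Rightarrow> int mv_struct" where
  "S_alg m = Gamma (int m)"

definition S_omega_alg :: "nat \<Rightarrow> lexint mv_struct" where
  "S_omega_alg m = Gamma (Lex (int m) 0)"

text \<open>
  The variety generated by a family of MV-algebras is the class of MV-algebras that satisfy
  all identities valid in the family; its members are taken on an arbitrary carrier type.
\<close>

definition generated_variety :: "nat set \<Rightarrow> nat set \<Rightarrow> 'a mv_struct set" where
  "generated_variety I J =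
    {A. mv_algebra A \<and>
        (\<forall>s t. (\<forall>i\<in>I. mv_satisfies (S_alg i) s t) \<and>
               (\<forall>j\<in>J. mv_satisfies (S_omega_alg j) s t) \<longrightarrow> mv_satisfies A s t)}"

text \<open>
  The pair \<open>(I, J)\<close> is a presentation of \<open>V\<close>. The axioms below are written in terms of it,
  so every presentation of the same variety is covered.
\<close>

definition is_Komori_variety :: "'a mv_struct set \<Rightarrow> nat set \<Rightarrow> nat set \<Rightarrow> bool" where
  "is_Komori_variety V I J \<longleftrightarrow>
    finite I \<and> finite J \<and> (\<forall>i\<in>I. 0 < i) \<and> (\<forall>j\<in>J. 0 < j) \<and> I \<union> J \<noteq> {} \<and>
    V = generated_variety I J"

definition komori_rank :: "nat set \<Rightarrow> nat set \<Rightarrow> nat" where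
  "komori_rank I J = Lcm (I \<union> J)"

definition MV_theory :: "'i sequent set" where
  "MV_theory = {Top \<turnstile>\<^bsub>k\<^esub> Eq s t | k s t. (k, s, t) \<in> mv_axioms}"

definition T_V :: "nat set \<Rightarrow> nat set \<Rightarrow> 'i sequent set" where
  "T_V I J =
    (let N = Max (I \<union> J); n = komori_rank I J; x = Var 0 in
     MV_theory
     \<union> {Top \<turnstile>\<^bsub>1\<^esub> Eq (tpow (tmul (N + 1) (tpow x N)) 2) (tmul 2 (tpow x (N + 1)))}
     \<union> {Top \<turnstile>\<^bsub>1\<^esub> Eq (tpow (tmul p (tpow x (p - 1))) (N + 1)) (tmul (N + 1) (tpow x p)) | p.
          1 < p \<and> p < N \<and> (\<forall>m\<in>I \<union> J. \<not> p dvd m)}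
     \<union> {Top \<turnstile>\<^bsub>1\<^esub> Eq (tmul (N + 1) (tpow x q)) (tmul (N + 2) (tpow x q)) | q.
          (\<exists>i\<in>I. q dvd i) \<and> (\<forall>j\<in>J. \<not> q dvd j)}
     \<union> {Top \<turnstile>\<^bsub>1\<^esub> Eq (tpow (tmul (n + 1) (tpow x n)) 2) (tmul 2 (tpow x (n + 1)))})"

text \<open>
  Sequences of terms are indexed from 1 (the value at 0 is irrelevant) and \<open>seq_plus\<close> is
  Mundici's addition of good sequences. In \<open>Gamma u\<close> the \<open>(\<chi> + 1)\<close>-th component of
  \<open>\<xi>\<close> times the sequence \<open>(x, 0, 0, ...)\<close> is \<open>inf u (sup 0 (\<xi> x - \<chi> u))\<close>.
\<close>

definition seq_plus :: "(nat \<Rightarrow> mvterm) \<Rightarrow> (nat \<Rightarrow> mvterm) \<Rightarrow> nat \<Rightarrow> mvterm" where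
  "seq_plus a b i = foldl (\<oplus>) (a i) (map (\<lambda>k. a (i - k) \<odot> b k) [1..<i] @ [b i])"

definition seq_single :: "mvterm \<Rightarrow> nat \<Rightarrow> mvterm" where
  "seq_single x i = (if i = 1 then x else Zero)"

primrec seq_mul :: "nat \<Rightarrow> (nat \<Rightarrow> mvterm) \<Rightarrow> nat \<Rightarrow> mvterm" where
  "seq_mul 0 a = (\<lambda>i. Zero)"
| "seq_mul (Suc k) a = seq_plus (seq_mul k a) a"

definition bezout :: "nat \<Rightarrow> nat \<Rightarrow> nat \<times> nat" where
  "bezout d n = (THE (\<xi>, \<chi>). \<xi> \<le> n div gcd d n \<and> \<chi> \<le> d div gcd d n \<and>
     int (gcd d n) = int \<xi> * int d - int \<chi> * int n)"

definition D_term :: "nat \<Rightarrow> nat \<Rightarrow> mvterm \<Rightarrow> mvterm" where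
  "D_term d n x = (case bezout d n of (\<xi>, \<chi>) \<Rightarrow> seq_mul \<xi> (seq_single x) (\<chi> + 1))"

definition rad_equiv :: "nat \<Rightarrow> mvterm \<Rightarrow> mvterm \<Rightarrow> 'i fm" where
  "rad_equiv n z w = Eq (tpow (tmul (n + 1) (tdist z w)) 2) Zero"

definition Fin_fm :: "nat \<Rightarrow> nat \<Rightarrow> mvterm \<Rightarrow> 'i fm" where
  "Fin_fm d n x =
    (if d = 0 then Eq (tpow (tmul (n + 1) x) 2) Zero
     else (let D = gcd d n; y = D_term d n x in
       And (rad_equiv n x (tmul (d div D) y))
         (big_and (map (\<lambda>k. rad_equiv n (Neg (tmul k y)) (tmul (n div D - k) y))
            [0..<n div D + 1]))))"

definition nontriviality :: "'i sequent" where
  "nontriviality = (Eq Zero One \<turnstile>\<^bsub>0\<^esub> Bot)"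

definition sigma_seq :: "nat \<Rightarrow> 'i sequent" where
  "sigma_seq n = (Top \<turnstile>\<^bsub>1\<^esub>
    Or (Eq (tpow (tmul (n + 1) (Var 0)) 2) Zero) (Eq (tmul (n + 1) (Var 0)) One))"

definition rho_seq :: "nat \<Rightarrow> 'i sequent" where
  "rho_seq n = (Top \<turnstile>\<^bsub>1\<^esub> big_or (map (\<lambda>d. Fin_fm d n (Var 0)) [0..<n + 1]))"

definition Loc1 :: "nat set \<Rightarrow> nat set \<Rightarrow> 'i sequent set" where
  "Loc1 I J = T_V I J \<union> {sigma_seq (komori_rank I J), nontriviality}"

definition Loc2 :: "nat set \<Rightarrow> nat set \<Rightarrow> 'i sequent set" where
  "Loc2 I J = T_V I J \<union> {rho_seq (komori_rank I J), nontriviality}"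

end

theory Submission
  imports Defs
begin

text \<open>
  Write \<open>n\<close> for the rank of the variety and \<open>N\<close> for the maximum of \<open>I \<union> J\<close>. In both theories the context \<open>x\<close> can be evaluated
  in a finite chain \<open>S\<^sub>m\<close> with \<open>m\<close> dividing \<open>n\<close>, and there both axioms are elementary:
  \<open>((n + 1)\<delta>)\<^sup>2 = 0\<close> says \<open>\<delta> = 0\<close> because \<open>m \<le> n\<close>, and \<open>x\<close> in \<open>Fin\<^sub>d\<close> says
  that \<open>x\<close> is the fraction \<open>d / n\<close> of the unit. What has to be explained is how a
  derivation reaches such an evaluation and comes back.

  A formula \<open>E\<close> in one variable makes the terms into an MV-algebra, by identifying terms that
  \<open>E\<close> proves equal (\<open>generic_model\<close>). Instead of forming quotients, everything takes place on
  the set of terms with varying preorders: an ideal coarsens the preorder, and Zorn's lemma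
  gives a total coarsening in which a chosen element stays nonzero
  (\<open>maximal_total_extension\<close>). If the chosen element is the unit, the result is a simple chain.
  The axiom with \<open>N\<close> bounds the order of its elements, so it is some \<open>S\<^sub>m\<close>, and the
  axioms with \<open>N\<close> and \<open>p\<close> force \<open>m\<close> to divide \<open>n\<close> (\<open>embedding_in_S_alg\<close>). Hence
  every nontrivial model of the identities has a point in some \<open>S\<^sub>m\<close> with \<open>m\<close> dividing
  \<open>n\<close> (\<open>standard_point\<close>).

  From \<open>\<sigma>\<^sub>n\<close> to \<open>\<rho>\<^sub>n\<close>: every \<open>Fin\<^sub>d\<close> is a conjunction of equations
  \<open>((n + 1)\<delta>)\<^sup>2 = 0\<close>. Split the derivation into cases by \<open>\<sigma>\<^sub>n\<close> at each of the finitely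
  many terms \<open>\<delta>\<close>. In a consistent branch take a point in \<open>S\<^sub>m\<close>; there \<open>x\<close> is a
  fraction \<open>d / n\<close>, so the terms \<open>\<delta>\<close> of \<open>Fin\<^sub>d\<close> vanish. Then \<open>(n + 1)\<delta> = 1\<close> is
  impossible in this branch, which therefore proves all equations of \<open>Fin\<^sub>d\<close>.

  From \<open>\<rho>\<^sub>n\<close> to \<open>\<sigma>\<^sub>n\<close>: \<open>Fin\<^sub>0\<close> is the first alternative of \<open>\<sigma>\<^sub>n\<close>, and for
  \<open>d \<ge> 1\<close> the formula \<open>Fin\<^sub>d\<close> implies the second one, \<open>(n + 1)x = 1\<close>. Points
  in \<open>S\<^sub>m\<close> alone cannot show this, since they only detect equations up to infinitesimals. The
  last axiom of the variety helps: in a chain where \<open>(n + 1)x\<close> is not the unit it is at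
  most one half (\<open>gap\<close>). So if \<open>z = \<not>(n + 1)x\<close> is nonzero, choose a chain in which it stays
  nonzero. There \<open>2z = 1\<close>, an equation that survives in a simple quotient and forces \<open>x = 0\<close>
  in \<open>S\<^sub>m\<close>, whereas \<open>Fin\<^sub>d\<close> forces \<open>x > 0\<close> (\<open>fin_imp_large\<close>).
\<close>

section \<open>MV-algebras as preorders on terms\<close>

text \<open>
  A preorder on terms whose quotient by mutual inequality is an MV-algebra. Keeping the carrier
  fixed and coarsening the preorder replaces the passage to quotients, which would need a new
  type for every ideal.
\<close>
locale mv_order =
  fixes le :: "mvterm \<Rightarrow> mvterm \<Rightarrow> bool" (infix "\<sqsubseteq>" 50)
  assumes refl [simp]: "x \<sqsubseteq> x"
    and trans [trans]: "x \<sqsubseteq> y \<Longrightarrow> y \<sqsubseteq> z \<Longrightarrow> x \<sqsubseteq> z"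
    and plus_mono1: "x \<sqsubseteq> y \<Longrightarrow> x \<oplus> z \<sqsubseteq> y \<oplus> z"
    and neg_anti: "x \<sqsubseteq> y \<Longrightarrow> Neg y \<sqsubseteq> Neg x"
    and neg_neg1: "Neg (Neg x) \<sqsubseteq> x"
    and neg_neg2: "x \<sqsubseteq> Neg (Neg x)"
    and comm: "x \<oplus> y \<sqsubseteq> y \<oplus> x"
    and assoc1: "(x \<oplus> y) \<oplus> z \<sqsubseteq> x \<oplus> (y \<oplus> z)"
    and le_plus1: "x \<sqsubseteq> x \<oplus> y"
    and plus_zero: "x \<oplus> Zero \<sqsubseteq> x"
    and le_iff: "x \<sqsubseteq> y \<longleftrightarrow> One \<sqsubseteq> Neg x \<oplus> y"
    and luk: "Neg (Neg x \<oplus> y) \<oplus> y \<sqsubseteq> Neg (Neg y \<oplus> x) \<oplus> x"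

locale mv_congruence =
  fixes eq :: "mvterm \<Rightarrow> mvterm \<Rightarrow> bool" (infix "\<approx>" 50)
  assumes refl [simp]: "x \<approx> x"
    and sym: "x \<approx> y \<Longrightarrow> y \<approx> x"
    and trans [trans]: "x \<approx> y \<Longrightarrow> y \<approx> z \<Longrightarrow> x \<approx> z"
    and neg: "x \<approx> y \<Longrightarrow> Neg x \<approx> Neg y"
    and plus: "x \<approx> x' \<Longrightarrow> y \<approx> y' \<Longrightarrow> x \<oplus> y \<approx> x' \<oplus> y'"
    and assoc: "(x \<oplus> y) \<oplus> z \<approx> x \<oplus> (y \<oplus> z)"
    and comm: "x \<oplus> y \<approx> y \<oplus> x"
    and zero: "x \<oplus> Zero \<approx> x"
    and neg_neg: "Neg (Neg x) \<approx> x"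
    and absorb: "x \<oplus> Neg Zero \<approx> Neg Zero"
    and luk: "Neg (Neg x \<oplus> y) \<oplus> y \<approx> Neg (Neg y \<oplus> x) \<oplus> x"
begin

definition le :: "mvterm \<Rightarrow> mvterm \<Rightarrow> bool" where
  "le x y \<longleftrightarrow> Neg x \<oplus> y \<approx> One"

lemma zero_left: "Zero \<oplus> x \<approx> x"
  by (rule trans[OF comm zero])

lemma one_left: "One \<oplus> x \<approx> One"
  unfolding One_def by (rule trans[OF comm absorb])

lemma neg_one: "Neg One \<approx> Zero"
  unfolding One_def by (rule neg_neg)

lemma excluded_middle: "Neg x \<oplus> x \<approx> One"
proof -
  have "One \<approx> Neg (Neg x \<oplus> Neg Zero) \<oplus> Neg Zero"
    unfolding One_def by (rule sym[OF absorb])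
  also have "\<dots> \<approx> Neg (Neg (Neg Zero) \<oplus> x) \<oplus> x" by (rule luk)
  also have "\<dots> \<approx> Neg (Zero \<oplus> x) \<oplus> x" by (intro plus neg neg_neg refl)
  also have "\<dots> \<approx> Neg x \<oplus> x" by (intro plus neg zero_left refl)
  finally show ?thesis by (rule sym)
qed

text \<open>
  The natural order of an MV-algebra, described algebraically. Transitivity and monotonicity of
  the order are immediate from this description.
\<close>
lemma le_iff_ex: "le x y \<longleftrightarrow> (\<exists>z. y \<approx> x \<oplus> z)"
proof
  assume l: "le x y"
  have "y \<approx> Zero \<oplus> y" by (rule sym[OF zero_left])
  also have "\<dots> \<approx> Neg (Neg x \<oplus> y) \<oplus> y"
    by (intro plus sym[OF trans[OF neg neg_one]] refl) (use l in \<open>simp add: le_def\<close>)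
  also have "\<dots> \<approx> Neg (Neg y \<oplus> x) \<oplus> x" by (rule luk)
  also have "\<dots> \<approx> x \<oplus> Neg (Neg y \<oplus> x)" by (rule comm)
  finally show "\<exists>z. y \<approx> x \<oplus> z" ..
next
  assume "\<exists>z. y \<approx> x \<oplus> z"
  then obtain z where "y \<approx> x \<oplus> z" ..
  then have "Neg x \<oplus> y \<approx> Neg x \<oplus> (x \<oplus> z)" by (intro plus refl)
  also have "\<dots> \<approx> (Neg x \<oplus> x) \<oplus> z" by (rule sym[OF assoc])
  also have "\<dots> \<approx> One \<oplus> z" by (intro plus excluded_middle refl)
  also have "\<dots> \<approx> One" by (rule one_left)
  finally show "le x y" by (simp add: le_def)
qed

lemma eq_imp_le: "x \<approx> y \<Longrightarrow> le x y"
  unfolding le_iff_ex by (rule HOL.exI[of _ Zero]) (rule sym[OF trans[OF zero]])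

lemma one_le_iff: "le One x \<longleftrightarrow> x \<approx> One"
proof -
  have "Neg One \<oplus> x \<approx> x"
    by (rule trans[OF plus[OF neg_one refl] zero_left])
  then show ?thesis unfolding le_def by (meson sym trans)
qed

lemma mv_order: "mv_order le"
proof
  show "le x x" for x by (simp add: eq_imp_le)
  show "le x z" if xyz: "le x y" "le y z" for x y z
  proof -
    obtain u v where "y \<approx> x \<oplus> u" "z \<approx> y \<oplus> v" using xyz by (auto simp: le_iff_ex)
    then have "z \<approx> (x \<oplus> u) \<oplus> v" by (meson trans plus refl)
    also have "\<dots> \<approx> x \<oplus> (u \<oplus> v)" by (rule assoc)
    finally show ?thesis using le_iff_ex by blast
  qed
  show "le (x \<oplus> z) (y \<oplus> z)" if xy: "le x y" for x y z
  proof -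
    obtain u where "y \<approx> x \<oplus> u" using xy by (auto simp: le_iff_ex)
    then have "y \<oplus> z \<approx> (x \<oplus> u) \<oplus> z" by (intro plus refl)
    also have "\<dots> \<approx> x \<oplus> (u \<oplus> z)" by (rule assoc)
    also have "\<dots> \<approx> x \<oplus> (z \<oplus> u)" by (intro plus comm refl)
    also have "\<dots> \<approx> (x \<oplus> z) \<oplus> u" by (rule sym[OF assoc])
    finally show ?thesis using le_iff_ex by blast
  qed
  show "le (Neg y) (Neg x)" if "le x y" for x y
  proof -
    have "Neg (Neg y) \<oplus> Neg x \<approx> y \<oplus> Neg x" by (intro plus neg_neg refl)
    also have "\<dots> \<approx> Neg x \<oplus> y" by (rule comm)
    also have "\<dots> \<approx> One" using that by (simp add: le_def)
    finally show ?thesis by (simp add: le_def)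
  qed
  show "le x (x \<oplus> y)" for x y
    unfolding le_iff_ex by (rule HOL.exI[of _ y]) (rule refl)
  show "le x y \<longleftrightarrow> le One (Neg x \<oplus> y)" for x y
    by (simp only: one_le_iff) (simp add: le_def)
qed (auto intro: eq_imp_le neg_neg sym[OF neg_neg] comm assoc zero luk)

end

context mv_order begin

abbreviation monus :: "mvterm \<Rightarrow> mvterm \<Rightarrow> mvterm" (infixl "\<ominus>" 65) where
  "x \<ominus> y \<equiv> Neg (Neg x \<oplus> y)"

lemma plus_mono: "x \<sqsubseteq> x' \<Longrightarrow> y \<sqsubseteq> y' \<Longrightarrow> x \<oplus> y \<sqsubseteq> x' \<oplus> y'"
  by (meson trans plus_mono1 comm)

lemma assoc2: "x \<oplus> (y \<oplus> z) \<sqsubseteq> (x \<oplus> y) \<oplus> z"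
  by (meson trans comm assoc1 plus_mono refl)

lemma zero_plus: "Zero \<oplus> x \<sqsubseteq> x"
  by (meson trans comm plus_zero)

lemma zero_le: "Zero \<sqsubseteq> x"
  by (meson trans le_plus1 zero_plus)

lemma le_plus2: "x \<sqsubseteq> y \<oplus> x"
  by (meson trans comm le_plus1)

lemma le_one: "x \<sqsubseteq> One"
  unfolding One_def by (meson neg_anti zero_le neg_neg2 trans)

lemma neg_one: "Neg One \<sqsubseteq> Zero"
  unfolding One_def by (rule neg_neg1)

lemma neg_swap: "Neg x \<sqsubseteq> y \<Longrightarrow> Neg y \<sqsubseteq> x"
  by (meson neg_anti neg_neg1 trans)

lemma neg_swap2: "x \<sqsubseteq> Neg y \<Longrightarrow> y \<sqsubseteq> Neg x"
  by (meson neg_anti neg_neg2 trans)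

lemma one_le_excluded: "One \<sqsubseteq> Neg x \<oplus> x"
  using le_iff refl by blast

text \<open>
  Truncated subtraction is residuated with addition. This is associativity, read through the
  characterisation of the order by the implication \<open>\<not>x \<oplus> y\<close>.
\<close>
lemma monus_le_iff: "x \<ominus> y \<sqsubseteq> z \<longleftrightarrow> x \<sqsubseteq> y \<oplus> z"
proof -
  have "x \<ominus> y \<sqsubseteq> z \<longleftrightarrow> One \<sqsubseteq> Neg (x \<ominus> y) \<oplus> z" by (rule le_iff)
  also have "\<dots> \<longleftrightarrow> One \<sqsubseteq> (Neg x \<oplus> y) \<oplus> z"
    by (meson trans plus_mono1 neg_neg1 neg_neg2)
  also have "\<dots> \<longleftrightarrow> One \<sqsubseteq> Neg x \<oplus> (y \<oplus> z)" by (meson trans assoc1 assoc2)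
  also have "\<dots> \<longleftrightarrow> x \<sqsubseteq> y \<oplus> z" by (rule le_iff[symmetric])
  finally show ?thesis .
qed

lemma le_plus_monus: "x \<sqsubseteq> y \<oplus> (x \<ominus> y)"
  using monus_le_iff refl by blast

lemma monus_le: "x \<ominus> y \<sqsubseteq> x"
  using monus_le_iff le_plus2 by blast

lemma monus_le_zero_iff: "x \<ominus> y \<sqsubseteq> Zero \<longleftrightarrow> x \<sqsubseteq> y"
  unfolding monus_le_iff by (meson plus_zero le_plus1 trans)

lemma monus_mono: "x \<sqsubseteq> x' \<Longrightarrow> y' \<sqsubseteq> y \<Longrightarrow> x \<ominus> y \<sqsubseteq> x' \<ominus> y'"
  by (intro neg_anti plus_mono)

lemma plus_monus_le: "y \<sqsubseteq> x \<Longrightarrow> y \<oplus> (x \<ominus> y) \<sqsubseteq> x"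
  by (meson comm luk monus_le_zero_iff plus_mono1 trans zero_plus)

text \<open>
  The term \<open>(x \<ominus> y) \<oplus> y\<close> is the join, and the last MV-axiom says that it is symmetric. It is
  below every upper bound \<open>s\<close> because \<open>(s \<ominus> y) \<oplus> y\<close> is below \<open>s\<close>.
\<close>
lemma join_le: assumes "x \<sqsubseteq> s" "y \<sqsubseteq> s" shows "(x \<ominus> y) \<oplus> y \<sqsubseteq> s"
  by (meson assms comm plus_monus_le monus_mono plus_mono trans refl)

text \<open>
  A common lower bound \<open>t\<close> of \<open>p \<ominus> q\<close> and \<open>q \<ominus> p\<close> can be subtracted from the join \<open>j\<close> of
  \<open>p\<close> and \<open>q\<close> so that the result is still an upper bound of both. Hence \<open>j\<close> is below
  \<open>j \<ominus> t\<close>, which leaves no room for \<open>t\<close>.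
\<close>
lemma prelinear: assumes t: "t \<sqsubseteq> p \<ominus> q" "t \<sqsubseteq> q \<ominus> p" shows "t \<sqsubseteq> Zero"
proof -
  have aux: "p \<sqsubseteq> ((q \<ominus> p) \<oplus> p) \<ominus> t" if "t \<sqsubseteq> q \<ominus> p" for p q
  proof -
    let ?u = "q \<ominus> p"
    have "Neg (?u \<oplus> p) \<sqsubseteq> Neg p \<ominus> ?u"
      by (meson neg_anti comm neg_neg1 plus_mono refl trans)
    then have "Neg (?u \<oplus> p) \<oplus> t \<sqsubseteq> (Neg p \<ominus> ?u) \<oplus> ?u"
      by (rule plus_mono[OF _ that])
    also have "\<dots> \<sqsubseteq> Neg p"
      by (intro join_le refl) (meson neg_anti le_plus2)
    finally show ?thesis by (rule neg_swap2)
  qed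
  let ?j = "(q \<ominus> p) \<oplus> p"
  have "q \<sqsubseteq> ((p \<ominus> q) \<oplus> q) \<ominus> t" by (rule aux[OF t(1)])
  also have "\<dots> \<sqsubseteq> ?j \<ominus> t" by (intro monus_mono luk refl)
  finally have "?j \<sqsubseteq> ?j \<ominus> t" by (intro join_le aux t)
  then have 1: "Neg ?j \<oplus> t \<sqsubseteq> Neg ?j" by (rule neg_swap2)
  have "t \<sqsubseteq> ?j" by (meson t(2) trans le_plus1)
  then have "Neg ?j \<sqsubseteq> Neg t" by (rule neg_anti)
  then have "Neg ?j \<oplus> (Neg t \<ominus> Neg ?j) \<sqsubseteq> Neg t" by (rule plus_monus_le)
  moreover have "?j \<sqsubseteq> Neg t \<ominus> Neg ?j"
    using 1 by (meson comm neg_neg1 neg_swap2 plus_mono refl trans)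
  ultimately have "Neg ?j \<oplus> ?j \<sqsubseteq> Neg t" by (meson plus_mono refl trans)
  then have "One \<sqsubseteq> Neg t" using one_le_excluded trans by blast
  then show ?thesis by (meson neg_anti neg_neg2 neg_one trans)
qed

lemma tmul_mono: "x \<sqsubseteq> y \<Longrightarrow> tmul k x \<sqsubseteq> tmul k y"
  by (induction k) (auto intro: plus_mono)

lemma tmul_add1: "tmul (k + l) x \<sqsubseteq> tmul k x \<oplus> tmul l x"
  by (induction l) (auto intro: le_plus1 trans[OF plus_mono1] assoc1)

lemma tmul_add2: "tmul k x \<oplus> tmul l x \<sqsubseteq> tmul (k + l) x"
  by (induction l) (auto intro: plus_zero trans[OF _ plus_mono1] assoc2)

lemma tmul_mono_nat: "k \<le> l \<Longrightarrow> tmul k x \<sqsubseteq> tmul l x"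
  by (metis le_Suc_ex le_plus1 tmul_add2 trans)

lemma tmul_plus1: "tmul k (x \<oplus> y) \<sqsubseteq> tmul k x \<oplus> tmul k y"
proof (induction k)
  case 0 show ?case by (simp add: zero_le)
next
  case (Suc k)
  have "tmul k (x \<oplus> y) \<oplus> (x \<oplus> y) \<sqsubseteq> (tmul k x \<oplus> tmul k y) \<oplus> (x \<oplus> y)"
    by (rule plus_mono1[OF Suc])
  also have "\<dots> \<sqsubseteq> (tmul k x \<oplus> x) \<oplus> (tmul k y \<oplus> y)"
    by (meson assoc1 assoc2 comm plus_mono refl trans)
  finally show ?case by simp
qed

lemma tmul_double: "tmul (2 * k) x \<sqsubseteq> tmul k (x \<oplus> x)"
proof (induction k)
  case (Suc k)
  have "tmul (2 * Suc k) x = (tmul (2 * k) x \<oplus> x) \<oplus> x" by simp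
  also have "\<dots> \<sqsubseteq> tmul (2 * k) x \<oplus> (x \<oplus> x)" by (rule assoc1)
  also have "\<dots> \<sqsubseteq> tmul (Suc k) (x \<oplus> x)" using Suc by (simp add: plus_mono1)
  finally show ?case .
qed simp

text \<open>
  Disjointness passes to multiples: if \<open>t\<close> is below \<open>(k + 1)v\<close> then \<open>t \<ominus> kv\<close> is below
  both \<open>u\<close> and \<open>v\<close>, hence zero, and so \<open>t\<close> is already below \<open>kv\<close>.
\<close>
lemma disjoint_tmul:
  assumes "\<And>t. t \<sqsubseteq> u \<Longrightarrow> t \<sqsubseteq> v \<Longrightarrow> t \<sqsubseteq> Zero"
    and "t \<sqsubseteq> u" "t \<sqsubseteq> tmul k v"
  shows "t \<sqsubseteq> Zero"
  using assms(2,3)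
proof (induction k arbitrary: t)
  case (Suc k)
  have "t \<ominus> tmul k v \<sqsubseteq> v" using Suc.prems(2) by (simp add: monus_le_iff)
  moreover have "t \<ominus> tmul k v \<sqsubseteq> u" using Suc.prems(1) monus_le trans by blast
  ultimately have "t \<ominus> tmul k v \<sqsubseteq> Zero" using assms(1) by blast
  then show ?case using Suc monus_le_zero_iff by blast
qed simp

definition is_ideal :: "mvterm set \<Rightarrow> bool" where
  "is_ideal P \<longleftrightarrow> Zero \<in> P \<and> (\<forall>x y. x \<sqsubseteq> y \<longrightarrow> y \<in> P \<longrightarrow> x \<in> P) \<and>
    (\<forall>x\<in>P. \<forall>y\<in>P. x \<oplus> y \<in> P)"

lemma quotient_order:
  assumes P: "is_ideal P"
  shows "mv_order (\<lambda>x y. x \<ominus> y \<in> P)"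
proof -
  have down: "x \<in> P" if "x \<sqsubseteq> y" "y \<in> P" for x y using P that unfolding is_ideal_def by blast
  have zero: "x \<ominus> y \<in> P" if "x \<sqsubseteq> y" for x y
    using P that monus_le_zero_iff unfolding is_ideal_def by blast
  show ?thesis
  proof
    show "x \<ominus> z \<in> P" if "x \<ominus> y \<in> P" "y \<ominus> z \<in> P" for x y z
    proof (rule down)
      show "(y \<ominus> z) \<oplus> (x \<ominus> y) \<in> P" using P that unfolding is_ideal_def by blast
      have "x \<sqsubseteq> y \<oplus> (x \<ominus> y)" by (rule le_plus_monus)
      also have "\<dots> \<sqsubseteq> (z \<oplus> (y \<ominus> z)) \<oplus> (x \<ominus> y)" by (intro plus_mono1 le_plus_monus)
      also have "\<dots> \<sqsubseteq> z \<oplus> ((y \<ominus> z) \<oplus> (x \<ominus> y))" by (rule assoc1)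
      finally show "x \<ominus> z \<sqsubseteq> (y \<ominus> z) \<oplus> (x \<ominus> y)" by (simp add: monus_le_iff)
    qed
    show "(x \<oplus> z) \<ominus> (y \<oplus> z) \<in> P" if "x \<ominus> y \<in> P" for x y z
    proof (rule down[OF _ that])
      have "x \<oplus> z \<sqsubseteq> (y \<oplus> (x \<ominus> y)) \<oplus> z" by (intro plus_mono1 le_plus_monus)
      also have "\<dots> \<sqsubseteq> (y \<oplus> z) \<oplus> (x \<ominus> y)" by (meson assoc1 assoc2 comm plus_mono refl trans)
      finally show "(x \<oplus> z) \<ominus> (y \<oplus> z) \<sqsubseteq> x \<ominus> y" by (simp add: monus_le_iff)
    qed
    show "Neg y \<ominus> Neg x \<in> P" if "x \<ominus> y \<in> P" for x y
      by (rule down[OF _ that], rule neg_anti) (meson comm neg_neg2 plus_mono refl trans)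
    show "x \<ominus> y \<in> P \<longleftrightarrow> One \<ominus> (Neg x \<oplus> y) \<in> P" for x y
    proof -
      have "Neg One \<oplus> (Neg x \<oplus> y) \<sqsubseteq> Neg x \<oplus> y"
        by (meson neg_one plus_mono1 trans zero_plus)
      then show ?thesis using down neg_anti le_plus2 by blast
    qed
  qed (auto intro!: zero neg_neg1 neg_neg2 comm assoc1 le_plus1 plus_zero luk)
qed

text \<open>
  The prime ideal theorem. An ideal maximal among those without \<open>a\<close> gives a total preorder: were
  both \<open>p \<ominus> q\<close> and \<open>q \<ominus> p\<close> outside it, then \<open>a\<close> would be, up to the ideal, below a multiple
  of each, and these multiples are disjoint. The last conclusion records maximality; for
  \<open>a = One\<close> it says that the quotient is simple.
\<close>
lemma maximal_total_extension:
  assumes a: "\<not> a \<sqsubseteq> Zero"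
  obtains le' where "mv_order le'" "\<And>x y. x \<sqsubseteq> y \<Longrightarrow> le' x y" "\<not> le' a Zero"
    "\<And>x y. le' x y \<or> le' y x" "\<And>p. \<not> le' p Zero \<Longrightarrow> \<exists>k. le' a (tmul k p)"
proof -
  define F where "F = {P. is_ideal P \<and> a \<notin> P}"
  have "{x. x \<sqsubseteq> Zero} \<in> F"
    using a by (auto simp: F_def is_ideal_def intro: trans trans[OF plus_mono plus_zero])
  moreover have "\<Union>C \<in> F" if C: "C \<noteq> {}" "subset.chain F C" for C
  proof -
    have CF: "P \<in> F" if "P \<in> C" for P using C that by (auto simp: subset.chain_def)
    have "x \<oplus> y \<in> \<Union>C" if xy: "x \<in> \<Union>C" "y \<in> \<Union>C" for x y
    proof -
      obtain P Q where "P \<in> C" "x \<in> P" "Q \<in> C" "y \<in> Q" using xy by blast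
      moreover have "P \<subseteq> Q \<or> Q \<subseteq> P"
        using C(2) calculation by (auto simp: subset_chain_def)
      ultimately obtain R where "R \<in> C" "x \<in> R" "y \<in> R" by blast
      then have "x \<oplus> y \<in> R" using CF[of R] by (auto simp: F_def is_ideal_def)
      with \<open>R \<in> C\<close> show ?thesis by blast
    qed
    moreover have "Zero \<in> \<Union>C" "a \<notin> \<Union>C" using C(1) CF by (auto simp: F_def is_ideal_def)
    moreover have "x \<in> \<Union>C" if "x \<sqsubseteq> y" "y \<in> \<Union>C" for x y
      using that CF unfolding F_def is_ideal_def by blast
    ultimately show ?thesis unfolding F_def is_ideal_def by blast
  qed
  ultimately obtain P where P: "P \<in> F" and max: "\<And>X. X \<in> F \<Longrightarrow> P \<subseteq> X \<Longrightarrow> X = P"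
    using subset_Zorn_nonempty[of F] by (metis empty_iff)
  have idP: "is_ideal P" and aP: "a \<notin> P" using P by (auto simp: F_def)
  have down: "x \<in> P" if "x \<sqsubseteq> y" "y \<in> P" for x y using idP that unfolding is_ideal_def by blast
  have sum: "x \<oplus> y \<in> P" if "x \<in> P" "y \<in> P" for x y using idP that unfolding is_ideal_def by blast
  \<comment> \<open>maximality: the ideal generated by \<open>P\<close> and \<open>p\<close> contains \<open>a\<close>\<close>
  have gen: "\<exists>k. \<exists>i\<in>P. a \<sqsubseteq> i \<oplus> tmul k p" if p: "p \<notin> P" for p
  proof (rule ccontr)
    assume no: "\<not> ?thesis"
    let ?X = "{x. \<exists>k. \<exists>i\<in>P. x \<sqsubseteq> i \<oplus> tmul k p}"
    have "x \<oplus> y \<in> ?X" if x: "x \<in> ?X" and y: "y \<in> ?X" for x y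
    proof -
      obtain k i l j where "i \<in> P" "x \<sqsubseteq> i \<oplus> tmul k p" "j \<in> P" "y \<sqsubseteq> j \<oplus> tmul l p"
        using x y by blast
      then have "x \<oplus> y \<sqsubseteq> (i \<oplus> tmul k p) \<oplus> (j \<oplus> tmul l p)" by (intro plus_mono)
      also have "\<dots> \<sqsubseteq> (i \<oplus> j) \<oplus> (tmul k p \<oplus> tmul l p)"
        by (meson assoc1 assoc2 comm plus_mono refl trans)
      also have "\<dots> \<sqsubseteq> (i \<oplus> j) \<oplus> tmul (k + l) p" by (intro plus_mono refl tmul_add2)
      finally show ?thesis using sum \<open>i \<in> P\<close> \<open>j \<in> P\<close> by blast
    qed
    moreover have sub: "P \<subseteq> ?X" using le_plus1 by blast
    moreover have "Zero \<in> ?X" using sub idP unfolding is_ideal_def by blast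
    moreover have "x \<in> ?X" if "x \<sqsubseteq> y" "y \<in> ?X" for x y using that trans by blast
    ultimately have "?X \<in> F" using no unfolding F_def is_ideal_def by blast
    then have "?X = P" using max sub by blast
    moreover have "p \<sqsubseteq> Zero \<oplus> tmul 1 p" by (simp, meson le_plus2 trans)
    then have "p \<in> ?X" using idP unfolding is_ideal_def by blast
    ultimately show False using p by blast
  qed
  have zeroP: "x \<ominus> Zero \<in> P \<longleftrightarrow> x \<in> P" for x
    by (meson down monus_le monus_le_iff zero_plus refl trans)
  show thesis
  proof (rule that[of "\<lambda>x y. x \<ominus> y \<in> P"])
    show "mv_order (\<lambda>x y. x \<ominus> y \<in> P)" by (rule quotient_order[OF idP])
    show "x \<ominus> y \<in> P" if "x \<sqsubseteq> y" for x y
      using idP that monus_le_zero_iff unfolding is_ideal_def by blast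
    show "\<not> a \<ominus> Zero \<in> P" using aP zeroP by blast
    show "\<exists>k. a \<ominus> tmul k p \<in> P" if p: "\<not> p \<ominus> Zero \<in> P" for p
    proof -
      obtain k i where i: "i \<in> P" "a \<sqsubseteq> i \<oplus> tmul k p" using gen[of p] p zeroP by blast
      then have "a \<sqsubseteq> tmul k p \<oplus> i" by (rule_tac trans[OF _ comm])
      then show ?thesis using down i(1) by (auto simp flip: monus_le_iff)
    qed
    show "p \<ominus> q \<in> P \<or> q \<ominus> p \<in> P" for p q
    proof (rule ccontr)
      assume "\<not> ?thesis"
      then have "p \<ominus> q \<notin> P" "q \<ominus> p \<notin> P" by simp_all
      then obtain k i l j where ij: "i \<in> P" "j \<in> P"
        and 1: "a \<sqsubseteq> i \<oplus> tmul k (p \<ominus> q)" and 2: "a \<sqsubseteq> j \<oplus> tmul l (q \<ominus> p)"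
        by (meson gen)
      let ?b = "a \<ominus> (i \<oplus> j)"
      have b1: "?b \<sqsubseteq> tmul k (p \<ominus> q)"
        unfolding monus_le_iff by (meson 1 le_plus1 plus_mono1 trans)
      have b2: "?b \<sqsubseteq> tmul l (q \<ominus> p)"
        unfolding monus_le_iff by (meson 2 le_plus2 plus_mono1 trans)
      have "?b \<sqsubseteq> Zero"
      proof (rule disjoint_tmul[OF _ b1 b2])
        fix t assume t: "t \<sqsubseteq> tmul k (p \<ominus> q)" "t \<sqsubseteq> q \<ominus> p"
        show "t \<sqsubseteq> Zero" by (rule disjoint_tmul[OF _ t(2) t(1)]) (rule prelinear)
      qed
      then show False using aP down sum ij monus_le_zero_iff by blast
    qed
  qed
qed

end

section \<open>Simple chains are finite\<close>

text \<open>
  In the real unit interval the inequality fails exactly when \<open>1 - w\<close> lies strictly between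
  \<open>1 / (2 (K + 1))\<close> and \<open>(2 K + 1) / (2 K (K + 1))\<close>, an interval around \<open>1 / (K + 1)\<close>. This
  gap makes simple chains that satisfy the identity discrete.
\<close>
definition gap_identity :: "(mvterm \<Rightarrow> mvterm \<Rightarrow> bool) \<Rightarrow> nat \<Rightarrow> bool" where
  "gap_identity le K \<longleftrightarrow>
    (\<forall>w. le (tpow (tmul (K + 1) (tpow w K)) 2) (tmul 2 (tpow w (K + 1))))"

definition komori_identities :: "(mvterm \<Rightarrow> mvterm \<Rightarrow> bool) \<Rightarrow> nat set \<Rightarrow> nat set \<Rightarrow> bool" where
  "komori_identities le I J \<longleftrightarrow>
    (let N = Max (I \<union> J) in
      gap_identity le N \<and> gap_identity le (komori_rank I J) \<and>
      (\<forall>p. 1 < p \<and> p < N \<and> (\<forall>m\<in>I \<union> J. \<not> p dvd m) \<longrightarrow>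
        (\<forall>w. le (tpow (tmul p (tpow w (p - 1))) (N + 1)) (tmul (N + 1) (tpow w p)))))"

context mv_order begin

lemma tpow_Neg1: "tpow (Neg x) k \<sqsubseteq> Neg (tmul k x)"
proof (induction k)
  case (Suc k)
  then show ?case
    by (simp add: Odot_def neg_anti plus_mono neg_neg2 neg_swap2)
qed (simp add: One_def)

lemma tpow_Neg2: "Neg (tmul k x) \<sqsubseteq> tpow (Neg x) k"
proof (induction k)
  case (Suc k)
  then show ?case
    by (simp add: Odot_def neg_anti plus_mono neg_neg1 neg_swap)
qed (simp add: One_def)

lemma one_le_Odot: assumes "One \<sqsubseteq> x" "One \<sqsubseteq> y" shows "One \<sqsubseteq> x \<odot> y"
proof -
  have "Neg x \<oplus> Neg y \<sqsubseteq> Zero"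
    by (meson assms neg_anti neg_one plus_mono trans plus_zero)
  then show ?thesis unfolding Odot_def One_def by (rule neg_anti)
qed

lemma one_le_tpow: "One \<sqsubseteq> x \<Longrightarrow> One \<sqsubseteq> tpow x k"
  by (induction k) (auto intro: one_le_Odot)

text \<open>
  Compare \<open>x\<close> with \<open>v = \<not>(Kx)\<close>. If \<open>v\<close> is the smaller one, \<open>(K + 1)x\<close> exceeds
  \<open>v \<oplus> Kx = 1\<close>. Otherwise \<open>(K + 1)v = 1\<close>, so the left side of the identity at
  \<open>w = \<not>x\<close> is the unit, and the right side is \<open>2\<not>((K + 1)x)\<close>.
\<close>
lemma gap:
  assumes total: "\<And>x y. x \<sqsubseteq> y \<or> y \<sqsubseteq> x" and ax: "gap_identity le K"
  shows "One \<sqsubseteq> tmul (K + 1) x \<or> One \<sqsubseteq> tmul 2 (Neg (tmul (K + 1) x))"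
proof -
  let ?v = "Neg (tmul K x)"
  from total[of ?v x] show ?thesis
  proof
    assume "?v \<sqsubseteq> x"
    then have "?v \<oplus> tmul K x \<sqsubseteq> tmul K x \<oplus> x" by (meson comm plus_mono refl trans)
    then show ?thesis using one_le_excluded trans by auto
  next
    assume "x \<sqsubseteq> ?v"
    have "One \<sqsubseteq> ?v \<oplus> tmul K x" by (rule one_le_excluded)
    also have "\<dots> \<sqsubseteq> tmul K x \<oplus> ?v" by (rule comm)
    also have "\<dots> \<sqsubseteq> tmul (K + 1) ?v" using \<open>x \<sqsubseteq> ?v\<close> by (simp add: plus_mono1 tmul_mono)
    also have "\<dots> \<sqsubseteq> tmul (K + 1) (tpow (Neg x) K)" by (intro tmul_mono tpow_Neg2)
    finally have "One \<sqsubseteq> tpow (tmul (K + 1) (tpow (Neg x) K)) 2" by (rule one_le_tpow)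
    also have "\<dots> \<sqsubseteq> tmul 2 (tpow (Neg x) (K + 1))" using ax by (simp add: gap_identity_def)
    also have "\<dots> \<sqsubseteq> tmul 2 (Neg (tmul (K + 1) x))" by (intro tmul_mono tpow_Neg1)
    finally show ?thesis ..
  qed
qed

end

abbreviation val :: "nat \<Rightarrow> (nat \<Rightarrow> int) \<Rightarrow> mvterm \<Rightarrow> int" where
  "val m \<equiv> mv_eval (S_alg m)"

lemma S_alg_simps [simp]:
  "mv_carrier (S_alg m) = {0..int m}"
  "mv_zero (S_alg m) = 0"
  "mv_neg (S_alg m) a = int m - a"
  "mv_plus (S_alg m) a b = min (a + b) (int m)"
  by (simp_all add: S_alg_def Gamma_def inf_min)

locale mv_simple_chain = mv_order +
  assumes total: "x \<sqsubseteq> y \<or> y \<sqsubseteq> x"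
    and nontrivial: "\<not> One \<sqsubseteq> Zero"
    and simple: "\<not> p \<sqsubseteq> Zero \<Longrightarrow> \<exists>k. One \<sqsubseteq> tmul k p"
begin

text \<open>
  Take the first multiple \<open>kx\<close> with \<open>(K + 1)kx = 1\<close>. One step earlier, \<open>y = (K + 1)(k - 1)x\<close>
  is at most one half by the gap, and adding \<open>(K + 1)x\<close> reaches the unit. Hence \<open>(K + 1)x\<close> is
  at least \<open>\<not>y\<close>, thus at least one half.
\<close>
lemma bounded_order:
  assumes ax: "gap_identity le K" and x: "\<not> x \<sqsubseteq> Zero"
  shows "One \<sqsubseteq> tmul (2 * (K + 1)) x"
proof -
  let ?Y = "\<lambda>k. tmul (K + 1) (tmul k x)"
  obtain k where "One \<sqsubseteq> tmul k x" using simple x by blast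
  also have "tmul k x \<sqsubseteq> tmul (K + 1) (tmul k x)" by (simp add: le_plus2)
  finally have "\<exists>k. One \<sqsubseteq> ?Y k" by blast
  then obtain k where k: "One \<sqsubseteq> ?Y k" and least: "\<And>j. j < k \<Longrightarrow> \<not> One \<sqsubseteq> ?Y j"
    by (subst (asm) exists_least_iff) blast
  have Y0: "tmul j Zero \<sqsubseteq> Zero" for j
    by (induction j) (simp_all add: trans[OF plus_zero])
  have "k \<noteq> 0" using k Y0[of "K + 1"] nontrivial trans by (metis tmul.simps(1))
  then obtain j where j: "k = Suc j" by (cases k) auto
  have "\<not> One \<sqsubseteq> ?Y j" using least j by simp
  then have "One \<sqsubseteq> tmul 2 (Neg (?Y j))" using gap[OF total ax] by blast
  also have "tmul 2 (Neg (?Y j)) \<sqsubseteq> Neg (?Y j) \<oplus> Neg (?Y j)"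
    by (simp add: numeral_2_eq_2 plus_mono1 zero_plus)
  finally have half: "?Y j \<sqsubseteq> Neg (?Y j)" by (simp only: le_iff[symmetric])
  have "One \<sqsubseteq> ?Y j \<oplus> tmul (K + 1) x"
    using trans[OF k] tmul_plus1 unfolding j tmul.simps(2)[of j] by blast
  also have "\<dots> \<sqsubseteq> Neg (Neg (?Y j)) \<oplus> tmul (K + 1) x" by (intro plus_mono1 neg_neg2)
  finally have up: "Neg (?Y j) \<sqsubseteq> tmul (K + 1) x" using le_iff by blast
  have "One \<sqsubseteq> Neg (?Y j) \<oplus> ?Y j" by (rule one_le_excluded)
  also have "\<dots> \<sqsubseteq> tmul (K + 1) x \<oplus> tmul (K + 1) x"
    by (intro plus_mono up trans[OF half up])
  also have "\<dots> \<sqsubseteq> tmul ((K + 1) + (K + 1)) x" by (rule tmul_add2)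
  finally show ?thesis by (simp add: mult_2)
qed

text \<open>
  Let \<open>m\<close> be the largest order of a nonzero element, and let \<open>e\<close> have order \<open>m\<close>. Then \<open>e\<close> is
  an atom: an element strictly between \<open>0\<close> and \<open>e\<close>, or its difference to \<open>e\<close>, would be at
  most half of \<open>e\<close> and have a larger order. Every element is therefore a multiple of \<open>e\<close>.
\<close>
lemma isomorphic_S_alg:
  assumes bound: "\<And>x. \<not> x \<sqsubseteq> Zero \<Longrightarrow> One \<sqsubseteq> tmul K x"
  obtains m v e where "0 < m" "range v \<subseteq> {0..int m}" "val m v e = 1"
    "\<And>s t. s \<sqsubseteq> t \<longleftrightarrow> val m v s \<le> val m v t"
proof -
  define m where "m = (LEAST k. \<forall>x. \<not> x \<sqsubseteq> Zero \<longrightarrow> One \<sqsubseteq> tmul k x)"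
  have m: "One \<sqsubseteq> tmul m x" if "\<not> x \<sqsubseteq> Zero" for x
    using LeastI[of "\<lambda>k. \<forall>x. \<not> x \<sqsubseteq> Zero \<longrightarrow> One \<sqsubseteq> tmul k x" K] bound that
    unfolding m_def by blast
  have "m \<noteq> 0" using m[OF nontrivial] nontrivial by (metis tmul.simps(1))
  then have "\<not> (\<forall>x. \<not> x \<sqsubseteq> Zero \<longrightarrow> One \<sqsubseteq> tmul (m - 1) x)"
    unfolding m_def by (intro not_less_Least) simp
  then obtain e where e: "\<not> e \<sqsubseteq> Zero" and me: "\<not> One \<sqsubseteq> tmul (m - 1) e" by blast
  have atom: "e \<sqsubseteq> r" if re: "r \<sqsubseteq> e" and r: "\<not> r \<sqsubseteq> Zero" for r
  proof (rule ccontr)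
    assume er: "\<not> e \<sqsubseteq> r"
    define s where "s = e \<ominus> r"
    have s: "\<not> s \<sqsubseteq> Zero" using er monus_le_zero_iff by (simp add: s_def)
    obtain y where y: "\<not> y \<sqsubseteq> Zero" "y \<sqsubseteq> r" "y \<sqsubseteq> s"
      using total[of r s] r s refl by blast
    have "y \<oplus> y \<sqsubseteq> r \<oplus> s" by (intro plus_mono y)
    also have "\<dots> \<sqsubseteq> e" unfolding s_def by (rule plus_monus_le[OF re])
    finally have "tmul (2 * (m - 1)) y \<sqsubseteq> tmul (m - 1) e"
      using tmul_double tmul_mono trans by blast
    then have no: "\<not> One \<sqsubseteq> tmul (2 * (m - 1)) y" using me trans by blast
    have "\<not> m \<le> 2 * (m - 1)"
      using no m[OF y(1)] tmul_mono_nat trans by blast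
    then have "m = 1" using \<open>m \<noteq> 0\<close> by simp
    then have "One \<sqsubseteq> Zero \<oplus> r" using m[OF r] by simp
    then have "One \<sqsubseteq> r" using zero_plus trans by blast
    then show False using er le_one trans by blast
  qed
  have rep: "\<exists>k\<le>m. x \<sqsubseteq> tmul k e \<and> tmul k e \<sqsubseteq> x" for x
  proof -
    define A where "A = {k. k \<le> m \<and> tmul k e \<sqsubseteq> x}"
    have A: "finite A" "0 \<in> A" by (auto simp: A_def zero_le)
    define k where "k = Max A"
    have "k \<in> A" unfolding k_def using A by (intro Max_in) auto
    then have k: "k \<le> m" "tmul k e \<sqsubseteq> x" by (auto simp: A_def)
    have "x \<sqsubseteq> tmul k e"
    proof (cases "k = m")
      case True
      then show ?thesis using m[OF e] le_one trans by blast
    next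
      case False
      have "Suc k \<notin> A" using Max_ge[OF A(1), of "Suc k"] by (auto simp: k_def)
      then have no: "\<not> tmul (Suc k) e \<sqsubseteq> x" using False k by (auto simp: A_def)
      let ?r = "x \<ominus> tmul k e"
      have "?r \<sqsubseteq> Zero"
      proof (rule ccontr)
        assume "\<not> ?r \<sqsubseteq> Zero"
        then have "e \<sqsubseteq> ?r" using atom total by blast
        then have "tmul (Suc k) e \<sqsubseteq> tmul k e \<oplus> ?r" by (simp add: plus_mono)
        also have "\<dots> \<sqsubseteq> x" by (rule plus_monus_le[OF k(2)])
        finally show False using no by blast
      qed
      then show ?thesis by (simp only: monus_le_zero_iff)
    qed
    then show ?thesis using k by blast
  qed
  have strict: "k \<le> l" if kl: "k \<le> m" "tmul k e \<sqsubseteq> tmul l e" for k l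
  proof (rule ccontr)
    assume "\<not> k \<le> l"
    then have "l < k" by simp
    have stable: "tmul (l + j) e \<sqsubseteq> tmul l e" for j
    proof (induction j)
      case (Suc j)
      then have "tmul (l + Suc j) e \<sqsubseteq> tmul (Suc l) e" by (simp add: plus_mono1)
      also have "\<dots> \<sqsubseteq> tmul k e" using \<open>l < k\<close> by (intro tmul_mono_nat) simp
      also have "\<dots> \<sqsubseteq> tmul l e" by (rule kl)
      finally show ?case .
    qed simp
    have "One \<sqsubseteq> tmul m e" by (rule m[OF e])
    also have "\<dots> \<sqsubseteq> tmul l e" using stable[of "m - l"] \<open>l < k\<close> kl(1) by simp
    also have "\<dots> \<sqsubseteq> tmul (m - 1) e" using \<open>l < k\<close> kl(1) by (intro tmul_mono_nat) simp
    finally show False using me by blast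
  qed
  have mult_le_iff: "tmul k e \<sqsubseteq> tmul l e \<longleftrightarrow> k \<le> l" if "k \<le> m" for k l
    using strict tmul_mono_nat that by blast
  define h where "h x = (SOME k. k \<le> m \<and> x \<sqsubseteq> tmul k e \<and> tmul k e \<sqsubseteq> x)" for x
  have h: "h x \<le> m" "x \<sqsubseteq> tmul (h x) e" "tmul (h x) e \<sqsubseteq> x" for x
    using someI_ex[OF rep[of x]] unfolding h_def by auto
  have le_h: "x \<sqsubseteq> y \<longleftrightarrow> h x \<le> h y" for x y
    using mult_le_iff[OF h(1)] h(2,3) trans by meson
  have h_eqI: "h x = k" if "k \<le> m" "x \<sqsubseteq> tmul k e" "tmul k e \<sqsubseteq> x" for x k
    using that h strict by (meson le_antisym trans)
  have h_Zero: "h Zero = 0" by (rule h_eqI) auto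
  have h_plus: "h (x \<oplus> y) = min (h x + h y) m" for x y
  proof -
    have 1: "x \<oplus> y \<sqsubseteq> tmul (h x + h y) e"
      by (meson h(2) plus_mono tmul_add2 trans)
    have 2: "tmul (h x + h y) e \<sqsubseteq> x \<oplus> y"
      by (meson h(3) plus_mono tmul_add1 trans)
    show ?thesis
    proof (cases "h x + h y \<le> m")
      case True then show ?thesis using h_eqI[OF _ 1 2] by simp
    next
      case False
      then have "tmul m e \<sqsubseteq> tmul (h x + h y) e" by (intro tmul_mono_nat) simp
      then have "tmul m e \<sqsubseteq> x \<oplus> y" using 2 trans by blast
      moreover have "x \<oplus> y \<sqsubseteq> tmul m e" using m[OF e] le_one trans by blast
      ultimately have "h (x \<oplus> y) = m" by (intro h_eqI) auto
      then show ?thesis using False by simp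
    qed
  qed
  have h_One: "One \<sqsubseteq> x \<longleftrightarrow> h x = m" for x
  proof -
    have "h One = m" using m[OF e] le_one by (intro h_eqI) auto
    then show ?thesis using le_h[of One x] h(1)[of x] by auto
  qed
  have h_Neg: "h (Neg x) = m - h x" for x
  proof -
    have "h (Neg x \<oplus> x) = m" using h_One one_le_excluded by blast
    then have ge: "m \<le> h (Neg x) + h x" by (simp add: h_plus)
    have "\<not> m < h (Neg x) + h x"
    proof
      assume lt: "m < h (Neg x) + h x"
      then have pos: "0 < h (Neg x)" using h(1)[of x] by simp
      let ?y = "tmul (h (Neg x) - 1) e"
      have hy: "h ?y = h (Neg x) - 1" using h(1)[of "Neg x"] by (intro h_eqI) auto
      then have "h (x \<oplus> ?y) = m" using lt pos by (simp add: h_plus)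
      then have "One \<sqsubseteq> x \<oplus> ?y" using h_One by blast
      then have "One \<sqsubseteq> Neg (Neg x) \<oplus> ?y" using neg_neg2 plus_mono1 trans by blast
      then have "Neg x \<sqsubseteq> ?y" using le_iff by blast
      then show False using le_h hy pos by auto
    qed
    then show ?thesis using ge by simp
  qed
  define v where "v i = int (h (Var i))" for i
  have val_h: "val m v t = int (h t)" for t
    by (induction t) (auto simp: v_def h_Zero h_plus h_Neg h(1) of_nat_diff simp flip: of_nat_add)
  show thesis
  proof (rule that)
    show "0 < m" using \<open>m \<noteq> 0\<close> by simp
    show "range v \<subseteq> {0..int m}" using h(1) by (auto simp: v_def)
    have "h e = 1" using \<open>m \<noteq> 0\<close> by (intro h_eqI) (auto intro: le_plus2 zero_plus)
    then show "val m v e = 1" by (simp add: val_h)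
    show "s \<sqsubseteq> t \<longleftrightarrow> val m v s \<le> val m v t" for s t by (simp add: val_h le_h)
  qed
qed

end

section \<open>Evaluation in the finite chains\<close>

context
  fixes m :: nat and v :: "nat \<Rightarrow> int"
  assumes v: "range v \<subseteq> {0..int m}"
begin

lemma val_bounds [simp]: "0 \<le> val m v t" "val m v t \<le> int m"
proof -
  have "0 \<le> v i \<and> v i \<le> int m" for i using v by (simp add: image_subset_iff)
  then have "0 \<le> val m v t \<and> val m v t \<le> int m" by (induction t) auto
  then show "0 \<le> val m v t" "val m v t \<le> int m" by auto
qed

lemma val_One [simp]: "val m v One = int m"
  by (simp add: One_def)

lemma val_Odot: "val m v (s \<odot> t) = max 0 (val m v s + val m v t - int m)"
  by (simp add: Odot_def)

lemma val_tmul: "val m v (tmul k t) = min (int k * val m v t) (int m)"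
proof (induction k)
  case (Suc k)
  have "min (min p (int m) + val m v t) (int m) = min (p + val m v t) (int m)" for p
    using val_bounds[of t] by linarith
  from this[of "int k * val m v t"] show ?case
    using Suc by (simp add: distrib_right add.commute)
qed simp

lemma val_tpow: "val m v (tpow t k) = max 0 (int m - int k * (int m - val m v t))"
proof (induction k)
  case (Suc k)
  have "max 0 (max 0 p + val m v t - int m) = max 0 (p + val m v t - int m)" for p
    using val_bounds[of t] by linarith
  from this[of "int m - int k * (int m - val m v t)"] show ?case
    using Suc by (simp add: val_Odot algebra_simps)
qed simp

lemma val_tdist: "val m v (tdist s t) = \<bar>val m v s - val m v t\<bar>"
  unfolding tdist_def mv_eval.simps S_alg_simps val_Odot
  using val_bounds[of s] val_bounds[of t] by linarith

lemma val_foldl: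
  "val m v (foldl (\<oplus>) t ts) = min (val m v t + sum_list (map (val m v) ts)) (int m)"
proof (induction ts arbitrary: t)
  case (Cons s ts)
  have "0 \<le> sum_list (map (val m v) ts)" by (intro sum_list_nonneg) auto
  then show ?case using Cons by (auto simp: min_def)
qed simp

text \<open>
  The sum of \<open>k\<close> copies of \<open>(x, 0, 0, \<dots>)\<close> represents the integer \<open>kx\<close> by cutting it into
  pieces of length \<open>m\<close>: all entries are \<open>m\<close> until the remainder, and zero after it.
\<close>
lemma val_seq_mul:
  "val m v (seq_mul k (seq_single x) (Suc i)) =
    min (int m) (max 0 (int k * val m v x - int i * int m))"
proof (induction k arbitrary: i)
  case 0 show ?case by simp
next
  case (Suc k)
  let ?a = "seq_mul k (seq_single x)" and ?X = "val m v x"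
  let ?T = "int k * ?X - int i * int m"
  show ?case
  proof (cases i)
    case 0
    have "min (min (int m) (max 0 p) + ?X) (int m) = min (int m) (max 0 (p + ?X))"
      if "0 \<le> p" for p
      using that val_bounds[of x] by linarith
    from this[of "int k * ?X"] show ?thesis using Suc[of 0] 0
      by (simp add: seq_plus_def distrib_right add.commute) (simp add: seq_single_def)
  next
    case (Suc j)
    then have i: "i \<noteq> 0" by simp
    have upt: "[1..<Suc i] = 1 # [2..<Suc i]"
      using Suc by (simp add: upt_conv_Cons numeral_2_eq_2)
    \<comment> \<open>only the first summand \<open>a\<^sub>i \<odot> b\<^sub>1\<close> contributes, since \<open>b\<^sub>l\<close> is zero for \<open>l \<ge> 2\<close>\<close>
    have rest: "map (\<lambda>l. val m v (?a (Suc i - l) \<odot> seq_single x l)) [2..<Suc i] =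
        map (\<lambda>_. 0) [2..<Suc i]"
      by (rule map_cong) (auto simp: seq_single_def val_Odot intro!: max_absorb1)
    have "val m v (seq_mul (Suc k) (seq_single x) (Suc i)) =
        min (val m v (?a (Suc i)) + val m v (?a i \<odot> x)) (int m)"
      by (simp only: seq_mul.simps seq_plus_def upt val_foldl map_append list.map map_map
        comp_def rest append_Cons sum_list.Cons sum_list_append) (simp add: i seq_single_def del: upt_Suc)
    also have "\<dots> = min (min (int m) (max 0 ?T) + max 0 (min (int m) (max 0 (?T + int m)) + ?X - int m)) (int m)"
      using Suc.IH[of i] Suc.IH[of j] Suc by (simp add: val_Odot algebra_simps)
    also have "\<dots> = min (int m) (max 0 (?T + ?X))"
    proof -
      have "min (min a (max 0 T) + max 0 (min a (max 0 (T + a)) + X - a)) a = min a (max 0 (T + X))"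
        if "0 \<le> X" "X \<le> a" for a T X :: int
        using that by linarith
      then show ?thesis by simp
    qed
    also have "\<dots> = min (int m) (max 0 (int (Suc k) * ?X - int i * int m))"
      by (simp add: algebra_simps)
    finally show ?thesis .
  qed
qed

end

text \<open>
  Solutions differ by multiples of \<open>(n, d)\<close>, so in the box \<open>\<xi> \<le> n\<close> two of them could only have
  \<open>\<xi> = 0\<close> and \<open>\<xi> = n\<close>; but \<open>\<xi> = 0\<close> makes the right-hand side nonpositive. The case
  \<open>n = 1\<close> is separate because the residue of \<open>\<xi>\<close> modulo \<open>1\<close> is zero.
\<close>
lemma bezout_coprime_unique:
  fixes d n :: nat
  assumes "0 < d" "d \<le> n" "coprime d n"
  shows "\<exists>!(\<xi>, \<chi>). \<xi> \<le> n \<and> \<chi> \<le> d \<and> 1 = int \<xi> * int d - int \<chi> * int n"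
proof -
  let ?P = "\<lambda>\<xi> \<chi>. \<xi> \<le> n \<and> \<chi> \<le> d \<and> 1 = int \<xi> * int d - int \<chi> * int n"
  have "\<exists>\<xi> \<chi>. ?P \<xi> \<chi>"
  proof (cases "n = 1")
    case True
    then have "?P 1 0" using assms by simp
    then show ?thesis by blast
  next
    case False
    then have n: "1 < n" using assms by simp
    obtain x y where xy: "d * x = n * y + 1"
      using bezout_nat[of d n] assms by (auto simp: coprime_iff_gcd_eq_1)
    define \<xi> where "\<xi> = x mod n"
    have "(d * \<xi>) mod n = (d * x) mod n" by (simp add: \<xi>_def mod_simps)
    also have "\<dots> = 1" using n by (simp add: xy mod_Suc)
    finally have mod: "(d * \<xi>) mod n = 1" .
    define \<chi> where "\<chi> = (d * \<xi>) div n"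
    have eq: "d * \<xi> = \<chi> * n + 1" using div_mult_mod_eq[of "d * \<xi>" n] by (simp add: \<chi>_def mod)
    have "\<xi> < n" using n by (simp add: \<xi>_def)
    then have "d * \<xi> \<le> d * n" by simp
    then have "\<chi> * n \<le> d * n" using eq by linarith
    then have "\<chi> \<le> d" using n by simp
    moreover have "int \<xi> * int d - int \<chi> * int n = 1"
      using arg_cong[OF eq, of int] by (simp add: mult.commute)
    ultimately show ?thesis using \<open>\<xi> < n\<close> by (metis less_imp_le)
  qed
  moreover have "\<xi> = \<xi>' \<and> \<chi> = \<chi>'" if P: "?P \<xi> \<chi>" "?P \<xi>' \<chi>'" for \<xi> \<chi> \<xi>' \<chi>'
  proof -
    have pos: "0 < k" if "?P k l" for k l
    proof (rule ccontr)
      assume "\<not> 0 < k"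
      then have "1 = - (int l * int n)" using that by simp
      moreover have "0 \<le> int l * int n" by simp
      ultimately show False by linarith
    qed
    have e: "(int \<xi> - int \<xi>') * int d = (int \<chi> - int \<chi>') * int n"
      using P by (simp add: algebra_simps)
    then have "int n dvd (int \<xi> - int \<xi>') * int d" by simp
    then have "int n dvd int \<xi> - int \<xi>'"
      using assms(3) by (simp add: coprime_dvd_mult_left_iff coprime_commute)
    moreover have "\<bar>int \<xi> - int \<xi>'\<bar> < int n"
      using pos[OF P(1)] pos[OF P(2)] P by linarith
    ultimately have "int \<xi> - int \<xi>' = 0" by (meson dvd_imp_le_int not_less abs_of_nat
      zdvd_not_zless zero_less_abs_iff dvd_abs_iff)
    then show ?thesis using e assms by simp
  qed
  ultimately show ?thesis by (auto intro!: ex_ex1I)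
qed

lemma bezout_identity:
  assumes "0 < d" "d \<le> n" and b: "bezout d n = (\<xi>, \<chi>)"
  shows "int (gcd d n) = int \<xi> * int d - int \<chi> * int n"
proof -
  let ?D = "gcd d n"
  have D: "0 < ?D" using assms by simp
  have dn: "int d = int ?D * int (d div ?D)" "int n = int ?D * int (n div ?D)"
    by (simp_all flip: of_nat_mult)
  have iff: "int ?D = int k * int d - int l * int n \<longleftrightarrow>
      1 = int k * int (d div ?D) - int l * int (n div ?D)" for k l
  proof -
    have "int k * int d - int l * int n =
        int ?D * (int k * int (d div ?D) - int l * int (n div ?D))"
      by (subst dn(1), subst dn(2)) (simp add: algebra_simps)
    then show ?thesis using D by auto
  qed
  have "\<exists>!(\<xi>, \<chi>). \<xi> \<le> n div ?D \<and> \<chi> \<le> d div ?D \<and>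
      1 = int \<xi> * int (d div ?D) - int \<chi> * int (n div ?D)"
    using assms by (intro bezout_coprime_unique div_le_mono div_gcd_coprime)
      (auto simp: div_greater_zero_iff intro: dvd_imp_le)
  from theI'[OF this] show ?thesis
    using b unfolding bezout_def iff by (auto simp: iff)
qed

text \<open>
  If \<open>x\<close> is the fraction \<open>d / n\<close> of the unit, then \<open>\<xi> x - \<chi>\<close> is \<open>gcd d n / n\<close> by
  the choice of \<open>\<xi>\<close> and \<open>\<chi>\<close>; it lies between zero and the unit, so that the truncation in
  the term has no effect.
\<close>
lemma val_D_term:
  assumes v: "range v \<subseteq> {0..int m}" and d: "0 < d" "d \<le> n"
    and x: "val m v x * int n = int d * int m"
  shows "val m v (D_term d n x) * int n = int m * int (gcd d n)"
proof -
  obtain \<xi> \<chi> where b: "bezout d n = (\<xi>, \<chi>)" by fastforce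
  let ?y = "int \<xi> * val m v x - int \<chi> * int m"
  have "?y * int n = int \<xi> * (val m v x * int n) - int \<chi> * int m * int n"
    by (simp add: algebra_simps)
  also have "\<dots> = int m * (int \<xi> * int d - int \<chi> * int n)"
    by (simp only: x) (simp add: algebra_simps)
  also have "\<dots> = int m * int (gcd d n)" using bezout_identity[OF d b] by simp
  finally have y: "?y * int n = int m * int (gcd d n)" .
  have n: "0 < int n" using d by simp
  have "0 \<le> ?y * int n" by (simp add: y)
  then have "0 \<le> ?y" using n by (simp add: zero_le_mult_iff)
  moreover have "gcd d n \<le> n" using d by (intro gcd_le2_nat) simp
  then have "?y * int n \<le> int m * int n" by (simp add: y mult_left_mono)
  then have "?y \<le> int m" using n by simp
  ultimately show ?thesis using y by (simp add: D_term_def b val_seq_mul[OF v])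
qed

definition rad_term :: "nat \<Rightarrow> mvterm \<Rightarrow> mvterm" where
  "rad_term n t = tpow (tmul (n + 1) t) 2"

text \<open>
  The condition says that \<open>(n + 1)t\<close> is at most half of \<open>m\<close>, which no positive integer \<open>t\<close>
  satisfies when \<open>m \<le> n\<close>.
\<close>
lemma val_rad_term:
  assumes "range v \<subseteq> {0..int m}" "0 < m" "m \<le> n"
  shows "val m v (rad_term n t) \<le> 0 \<longleftrightarrow> val m v t = 0"
proof -
  let ?t = "val m v t"
  have "val m v (rad_term n t) \<le> 0 \<longleftrightarrow> 2 * min (int (n + 1) * ?t) (int m) \<le> int m"
    unfolding rad_term_def val_tpow[OF assms(1)] val_tmul[OF assms(1)] by auto
  also have "\<dots> \<longleftrightarrow> 2 * (int (n + 1) * ?t) \<le> int m" using assms(2) by (auto simp: min_def)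
  also have "\<dots> \<longleftrightarrow> ?t = 0"
  proof
    assume le: "2 * (int (n + 1) * ?t) \<le> int m"
    show "?t = 0"
    proof (rule ccontr)
      assume "?t \<noteq> 0"
      then have "1 \<le> ?t" using val_bounds(1)[OF assms(1), of t] by linarith
      then have "int (n + 1) * 1 \<le> int (n + 1) * ?t" by (intro mult_left_mono) auto
      from order_trans[OF mult_left_mono[OF this, of 2] le] show False
        using assms(2,3) by simp
    qed
  qed simp
  finally show ?thesis .
qed

text \<open>
  The terms \<open>\<delta>\<close> for which \<open>Fin_fm d n x\<close> asserts \<open>((n + 1)\<delta>)\<^sup>2 = 0\<close>.
\<close>
definition Fin_terms :: "nat \<Rightarrow> nat \<Rightarrow> mvterm \<Rightarrow> mvterm list" where
  "Fin_terms d n x =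
    (if d = 0 then [x]
     else (let D = gcd d n; y = D_term d n x in
       tdist x (tmul (d div D) y) #
         map (\<lambda>k. tdist (Neg (tmul k y)) (tmul (n div D - k) y)) [0..<n div D + 1]))"

lemma set_Fin_terms:
  "0 < d \<Longrightarrow> set (Fin_terms d n x) = insert (tdist x (tmul (d div gcd d n) (D_term d n x)))
    ((\<lambda>k. tdist (Neg (tmul k (D_term d n x))) (tmul (n div gcd d n - k) (D_term d n x))) `
      {0..n div gcd d n})"
  by (simp add: Fin_terms_def Let_def atLeastLessThanSuc_atLeastAtMost del: upt_Suc tmul.simps)

text \<open>
  The equation with \<open>k = 0\<close> says that a multiple of \<open>y\<close> is the unit, so \<open>y\<close> is positive, and
  \<open>x\<close> is a positive multiple of \<open>y\<close>.
\<close>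
lemma val_Fin_terms_pos:
  assumes v: "range v \<subseteq> {0..int m}" and m: "0 < m" and d: "0 < d" "d \<le> n"
    and Fin: "\<forall>\<delta>\<in>set (Fin_terms d n x). val m v \<delta> = 0"
  shows "0 < val m v x"
proof -
  define D y where "D = gcd d n" and "y = D_term d n x"
  have "val m v (tdist x (tmul (d div D) y)) = 0"
    using Fin d by (simp add: Fin_terms_def D_def y_def Let_def)
  then have x: "val m v x = min (int (d div D) * val m v y) (int m)"
    by (simp add: val_tdist[OF v] val_tmul[OF v])
  have "\<forall>k\<in>{0..n div D}. val m v (tdist (Neg (tmul k y)) (tmul (n div D - k) y)) = 0"
    using Fin unfolding set_Fin_terms[OF d(1)] D_def y_def by simp
  from bspec[OF this, of 0] have "val m v (tdist (Neg (tmul 0 y)) (tmul (n div D) y)) = 0"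
    by simp
  then have "int m \<le> int (n div D) * val m v y"
    by (simp add: val_tdist[OF v] val_tmul[OF v])
  then have "val m v y \<noteq> 0" using m by auto
  then have "0 < val m v y" using val_bounds(1)[OF v, of y] by linarith
  moreover have "0 < d div D"
    using d by (simp add: D_def div_greater_zero_iff dvd_imp_le)
  ultimately show ?thesis using m by (simp add: x)
qed

text \<open>
  As \<open>m\<close> divides \<open>n\<close>, the fraction \<open>x / m\<close> can be written with denominator \<open>n\<close>. The numerator
  is \<open>d\<close>, and \<open>y\<close> is then the fraction \<open>gcd d n / n\<close> of the unit, which measures both \<open>x\<close>
  and the unit.
\<close>
lemma val_Fin_terms_exists:
  assumes v: "range v \<subseteq> {0..int m}" and m: "0 < m" "m dvd n" and n: "0 < n"
  shows "\<exists>d\<le>n. \<forall>\<delta>\<in>set (Fin_terms d n x). val m v \<delta> = 0"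
proof -
  obtain q where q: "n = m * q" using m by blast
  have "0 < q" using n q by simp
  define d where "d = nat (val m v x) * q"
  have d_int: "int d = val m v x * int q" using val_bounds[OF v, of x] by (simp add: d_def)
  have "int d \<le> int m * int q" unfolding d_int using val_bounds[OF v] by (intro mult_right_mono) auto
  then have dn: "d \<le> n" by (simp add: q flip: of_nat_mult)
  have x: "val m v x * int n = int d * int m" by (simp add: d_int q)
  have "val m v \<delta> = 0" if \<delta>: "\<delta> \<in> set (Fin_terms d n x)" for \<delta>
  proof (cases "d = 0")
    case True
    then show ?thesis using \<delta> d_int \<open>0 < q\<close> by (simp add: Fin_terms_def)
  next
    case False
    define D y where "D = gcd d n" and "y = D_term d n x"
    have D: "0 < D" "D dvd d" "D dvd n" using False by (auto simp: D_def)
    have "val m v y * int n = int m * int D"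
      unfolding y_def D_def using False dn x by (intro val_D_term[OF v]) auto
    moreover have nD: "int n = int (n div D) * int D" using D by (simp flip: of_nat_mult)
    ultimately have "(val m v y * int (n div D)) * int D = int m * int D" by simp
    then have ny: "val m v y * int (n div D) = int m" using D by simp
    have "int d = int (d div D) * int D" using D by (simp flip: of_nat_mult)
    then have "(val m v x * int (n div D)) * int D = (int (d div D) * int m) * int D"
      using x nD by (simp add: algebra_simps)
    then have "val m v x * int (n div D) = int (d div D) * (val m v y * int (n div D))"
      using D ny by simp
    then have "val m v x * int (n div D) = (int (d div D) * val m v y) * int (n div D)"
      by simp
    moreover have "int (n div D) \<noteq> 0"
      using ny m(1) by (metis mult_zero_right of_nat_0_less_iff less_irrefl)
    ultimately have xy: "val m v x = int (d div D) * val m v y"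
      using mult_right_cancel by blast
    have ky: "int k * val m v y \<le> int m" if "k \<le> n div D" for k
      using mult_right_mono[of "int k" "int (n div D)" "val m v y"] ny that val_bounds[OF v, of y]
      by (simp add: mult.commute)
    have "val m v (tdist x (tmul (d div D) y)) = 0"
      using ky[of "d div D"] dn by (simp add: val_tdist[OF v] val_tmul[OF v] xy div_le_mono)
    moreover have "val m v (tdist (Neg (tmul k y)) (tmul (n div D - k) y)) = 0"
      if k: "k \<le> n div D" for k
    proof -
      have "int (n div D - k) * val m v y = int m - int k * val m v y"
        using k by (simp only: of_nat_diff left_diff_distrib mult.commute[of "int (n div D)"] ny)
      then show ?thesis using ky[OF k] val_bounds(1)[OF v, of y]
        by (simp add: val_tdist[OF v] val_tmul[OF v])
    qed
    ultimately show ?thesis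
      using \<delta> set_Fin_terms[of d n x] False unfolding D_def y_def by auto
  qed
  then show ?thesis using dn by blast
qed

section \<open>Models of the Komori identities\<close>

text \<open>
  The chain is some \<open>S\<^sub>m\<close>, and every integer between \<open>0\<close> and \<open>m\<close> is the value of a term, so
  the axioms can be tested at each of them. For \<open>m > N\<close> the axiom with \<open>N\<close> fails at
  \<open>m - k\<close> with \<open>k = m div (N + 1)\<close>. For \<open>m < N\<close> dividing no member of \<open>I \<union> J\<close> the axiom with
  \<open>p = m\<close> fails at \<open>m - 1\<close>. Otherwise \<open>m\<close> divides a member and hence the rank.
\<close>
lemma (in mv_simple_chain) embedding_in_S_alg:
  assumes I: "finite (I \<union> J)" "I \<union> J \<noteq> {}" "0 \<notin> I \<union> J" and id: "komori_identities le I J"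
  obtains m v where "0 < m" "m dvd komori_rank I J" "range v \<subseteq> {0..int m}"
    "\<And>s t. s \<sqsubseteq> t \<longleftrightarrow> val m v s \<le> val m v t"
proof -
  define N where "N = Max (I \<union> J)"
  have N: "N \<in> I \<union> J" unfolding N_def using I by (intro Max_in)
  have gap: "gap_identity le N" and excl: "\<And>p w. \<lbrakk>1 < p; p < N; \<forall>m\<in>I \<union> J. \<not> p dvd m\<rbrakk> \<Longrightarrow>
      tpow (tmul p (tpow w (p - 1))) (N + 1) \<sqsubseteq> tmul (N + 1) (tpow w p)"
    using id by (simp_all add: komori_identities_def N_def Let_def)
  obtain m v e where m: "0 < m" and v: "range v \<subseteq> {0..int m}" and e: "val m v e = 1"
    and le: "\<And>s t. s \<sqsubseteq> t \<longleftrightarrow> val m v s \<le> val m v t"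
    using isomorphic_S_alg[OF bounded_order[OF gap]] by metis
  have full: "val m v (Neg (tmul k e)) = int m - int k" if "k \<le> m" for k
    using that by (simp add: val_tmul[OF v] e)
  have "m \<le> N"
  proof (rule ccontr)
    assume "\<not> m \<le> N"
    define k where "k = m div (N + 1)"
    define q where "q = (N + 1) * k"
    have "0 < k" using \<open>\<not> m \<le> N\<close> by (simp add: k_def div_greater_zero_iff)
    have q: "q \<le> m" "m < q + (N + 1)" "N + 1 \<le> q"
    proof -
      have eq: "q + m mod (N + 1) = m" by (simp add: q_def k_def del: add_Suc_right)
      moreover have "m mod (N + 1) < N + 1" by simp
      ultimately show "q \<le> m" "m < q + (N + 1)" by linarith+
      show "N + 1 \<le> q" using mult_le_mono2[of 1 k "N + 1"] \<open>0 < k\<close> by (simp add: q_def)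
    qed
    have Nk: "int N * int k = int q - int k" "int (N + 1) * int k = int q"
      by (simp_all add: q_def algebra_simps)
    have "k \<le> m" using q(1) by (simp add: q_def)
    let ?w = "Neg (tmul k e)"
    have w: "val m v ?w = int m - int k" by (rule full[OF \<open>k \<le> m\<close>])
    have "val m v (tpow ?w N) = max 0 (int m - (int q - int k))"
      by (simp only: val_tpow[OF v] w) (simp add: Nk)
    then have wN: "val m v (tpow ?w N) = int m - int q + int k" using q(1) by simp
    have "int m = 1 * (int m - int q) + int q" by simp
    also have "\<dots> \<le> int (N + 1) * (int m - int q) + int q"
      using q(1) by (intro add_right_mono mult_right_mono) auto
    also have "\<dots> = int (N + 1) * (int m - int q + int k)"
      using Nk(2) by (simp add: distrib_left del: of_nat_add)
    finally have "int m \<le> int (N + 1) * (int m - int q + int k)" .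
    then have lhs: "val m v (tpow (tmul (N + 1) (tpow ?w N)) 2) = int m"
      by (simp only: val_tpow[OF v, of "tmul _ _"] val_tmul[OF v] wN) simp
    have "val m v (tpow ?w (N + 1)) = max 0 (int m - int q)"
      by (simp only: val_tpow[OF v] w) (use Nk(2) in simp)
    then have "val m v (tmul 2 (tpow ?w (N + 1))) \<le> 2 * (int m - int q)"
      using q(1) by (simp only: val_tmul[OF v])
    also have "\<dots> < int m" using q by simp
    finally show False using gap lhs le unfolding gap_identity_def
      by (metis not_less)
  qed
  moreover have "m dvd komori_rank I J"
  proof (cases "\<exists>i\<in>I \<union> J. m dvd i")
    case True
    then obtain i where i: "i \<in> I \<union> J" "m dvd i" by blast
    show ?thesis unfolding komori_rank_def by (rule dvd_trans[OF i(2) dvd_Lcm[OF i(1)]])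
  next
    case False
    then have no: "\<not> m dvd i" if "i \<in> I \<union> J" for i using that by blast
    then have "m \<noteq> N" "m \<noteq> 1" using no[OF N] by (metis dvd_refl, metis one_dvd)
    then have "1 < m" "m < N" using m \<open>m \<le> N\<close> by auto
    let ?w = "Neg (tmul 1 e)"
    have w: "val m v ?w = int m - 1" using full[of 1] m by simp
    have "val m v (tpow ?w (m - 1)) = 1"
      using m by (simp only: val_tpow[OF v] w) (simp add: of_nat_diff)
    then have "val m v (tpow (tmul m (tpow ?w (m - 1))) (N + 1)) = int m"
      by (simp only: val_tpow[OF v, of "tmul _ _"] val_tmul[OF v]) simp
    moreover have "val m v (tpow ?w m) = 0"
      by (simp only: val_tpow[OF v] w) simp
    then have "val m v (tmul (N + 1) (tpow ?w m)) = 0"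
      by (simp only: val_tmul[OF v])
    ultimately show ?thesis
      using excl[OF \<open>1 < m\<close> \<open>m < N\<close>, of ?w] no m unfolding le by simp
  qed
  ultimately show thesis using that m v le by blast
qed

lemma komori_identities_mono:
  assumes "komori_identities le I J" "\<And>s t. le s t \<Longrightarrow> le' s t"
  shows "komori_identities le' I J"
  using assms unfolding komori_identities_def gap_identity_def Let_def by blast

locale komori_order = mv_order +
  fixes I J :: "nat set"
  assumes finite: "finite (I \<union> J)" and nonempty: "I \<union> J \<noteq> {}" and pos: "0 \<notin> I \<union> J"
    and identities: "komori_identities le I J"
begin

abbreviation n :: nat where "n \<equiv> komori_rank I J"

lemma rank_pos: "0 < n"
  unfolding komori_rank_def using finite pos by (metis Lcm_0_iff gr0I)

lemma standard_point:
  assumes "\<not> One \<sqsubseteq> Zero"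
  obtains m v where "0 < m" "m dvd n" "range v \<subseteq> {0..int m}"
    "\<And>s t. s \<sqsubseteq> t \<Longrightarrow> val m v s \<le> val m v t"
proof -
  obtain le' where le': "mv_order le'" "\<And>x y. x \<sqsubseteq> y \<Longrightarrow> le' x y" "\<not> le' One Zero"
    "\<And>x y. le' x y \<or> le' y x" "\<And>p. \<not> le' p Zero \<Longrightarrow> \<exists>k. le' One (tmul k p)"
    using maximal_total_extension[OF assms] by blast
  interpret Q: mv_simple_chain le'
    using le' by (intro mv_simple_chain.intro mv_simple_chain_axioms.intro) auto
  show thesis
    using Q.embedding_in_S_alg[OF finite nonempty pos komori_identities_mono[OF identities le'(2)]]
      that le'(2) by metis
qed

text \<open>
  If \<open>z = \<not>(n + 1)x\<close> were nonzero, a chain in which it stays nonzero would satisfy \<open>2z = 1\<close>,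
  that is, \<open>(n + 1)x\<close> is at most one half there. A point of that chain in \<open>S\<^sub>m\<close> then has
  \<open>2 (n + 1) x \<le> m \<le> n\<close>, against \<open>x > 0\<close>. Two steps are needed because a maximal
  ideal that avoids a given nonzero \<open>z\<close> need not exist when \<open>z\<close> is infinitesimal.
\<close>
lemma fin_imp_large:
  assumes d: "0 < d" "d \<le> n"
    and Fin: "\<forall>\<delta>\<in>set (Fin_terms d n x). rad_term n \<delta> \<sqsubseteq> Zero"
  shows "One \<sqsubseteq> tmul (n + 1) x"
proof (rule ccontr)
  let ?z = "Neg (tmul (n + 1) x)"
  assume "\<not> One \<sqsubseteq> tmul (n + 1) x"
  then have nz: "\<not> ?z \<sqsubseteq> Zero"
    unfolding One_def by (meson neg_swap)
  obtain le' where le': "mv_order le'" "\<And>x y. x \<sqsubseteq> y \<Longrightarrow> le' x y" "\<not> le' ?z Zero"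
    "\<And>x y. le' x y \<or> le' y x"
    using maximal_total_extension[OF nz] by metis
  interpret Q: mv_order le' by (rule le')
  have id': "komori_identities le' I J" by (rule komori_identities_mono[OF identities le'(2)])
  interpret Q: komori_order le' I J
    using finite nonempty pos id' by unfold_locales
  have "\<not> le' One (tmul (n + 1) x)"
  proof
    assume "le' One (tmul (n + 1) x)"
    then have "le' ?z (Neg One)" by (rule Q.neg_anti)
    then show False using le'(3) Q.neg_one Q.trans by blast
  qed
  then have half: "le' One (tmul 2 ?z)"
    using Q.gap[OF le'(4)] id' by (auto simp: komori_identities_def Let_def)
  have "\<not> le' One Zero"
    using le'(3) Q.le_one Q.trans by blast
  then obtain m v where m: "0 < m" "m dvd n" and v: "range v \<subseteq> {0..int m}"
    and val: "\<And>s t. le' s t \<Longrightarrow> val m v s \<le> val m v t"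
    using Q.standard_point by metis
  have "m \<le> n" using m rank_pos by (intro dvd_imp_le)
  have "val m v \<delta> = 0" if "\<delta> \<in> set (Fin_terms d n x)" for \<delta>
    using val[OF le'(2), of "rad_term n \<delta>" Zero] Fin that
      val_rad_term[OF v m(1) \<open>m \<le> n\<close>] by simp
  then have "0 < val m v x" using val_Fin_terms_pos[OF v m(1) d] by blast
  then have "int (n + 1) * 1 \<le> int (n + 1) * val m v x" by (intro mult_left_mono) auto
  moreover have "int m \<le> int (n + 1) * 1" using \<open>m \<le> n\<close> by simp
  ultimately have "val m v (tmul (n + 1) x) = int m"
    unfolding val_tmul[OF v] by (intro min_absorb2) (rule order_trans)
  then have "val m v (tmul 2 ?z) = 0" by (simp only: val_tmul[OF v] mv_eval.simps S_alg_simps) simp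
  then show False using val[OF half] m(1) v by simp
qed

text \<open>
  A point in \<open>S\<^sub>m\<close> tells which \<open>d\<close> is the right one: its terms vanish at the point, so none
  of their multiples can be the unit.
\<close>
lemma fin_exists:
  assumes nt: "\<not> One \<sqsubseteq> Zero"
  shows "\<exists>d\<le>n. \<forall>\<delta>\<in>set (Fin_terms d n x). \<not> One \<sqsubseteq> tmul (n + 1) \<delta>"
proof -
  obtain m v where m: "0 < m" "m dvd n" and v: "range v \<subseteq> {0..int m}"
    and val: "\<And>s t. s \<sqsubseteq> t \<Longrightarrow> val m v s \<le> val m v t"
    using standard_point[OF nt] by metis
  obtain d where "d \<le> n" and d: "\<forall>\<delta>\<in>set (Fin_terms d n x). val m v \<delta> = 0"
    using val_Fin_terms_exists[OF v m rank_pos] by blast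
  moreover have "\<not> One \<sqsubseteq> tmul (n + 1) \<delta>" if "\<delta> \<in> set (Fin_terms d n x)" for \<delta>
  proof
    assume "One \<sqsubseteq> tmul (n + 1) \<delta>"
    from val[OF this] have "int m \<le> val m v (tmul (n + 1) \<delta>)" by (simp only: val_One[OF v])
    also have "\<dots> = 0" using d that by (simp only: val_tmul[OF v])
    finally show False using m by simp
  qed
  ultimately show ?thesis by blast
qed

end

section \<open>Derivations\<close>

lemma tsubst_One [simp]: "tsubst \<sigma> One = One"
  by (simp add: One_def)

lemma tsubst_Odot [simp]: "tsubst \<sigma> (s \<odot> t) = tsubst \<sigma> s \<odot> tsubst \<sigma> t"
  by (simp add: Odot_def)

lemma tsubst_tmul [simp]: "tsubst \<sigma> (tmul k t) = tmul k (tsubst \<sigma> t)"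
  by (induction k) auto

lemma tsubst_tpow [simp]: "tsubst \<sigma> (tpow t k) = tpow (tsubst \<sigma> t) k"
  by (induction k) auto

lemma tsubst_tsubst: "tsubst \<sigma> (tsubst \<tau> t) = tsubst (\<lambda>i. tsubst \<sigma> (\<tau> i)) t"
  by (induction t) auto

lemma tsubst_ident: "is_term k t \<Longrightarrow> (\<And>i. i < k \<Longrightarrow> \<sigma> i = Var i) \<Longrightarrow> tsubst \<sigma> t = t"
  by (induction t) auto

lemma is_term_One [simp]: "is_term k One"
  by (simp add: One_def)

lemma is_term_Odot [simp]: "is_term k (s \<odot> t) \<longleftrightarrow> is_term k s \<and> is_term k t"
  by (simp add: Odot_def)

lemma is_term_tdist [simp]: "is_term k (tdist s t) \<longleftrightarrow> is_term k s \<and> is_term k t"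
  by (auto simp: tdist_def)

lemma is_term_tmul [simp]: "is_term k t \<Longrightarrow> is_term k (tmul l t)"
  by (induction l) auto

lemma is_term_tpow [simp]: "is_term k t \<Longrightarrow> is_term k (tpow t l)"
  by (induction l) auto

lemma is_term_foldl:
  "is_term k (foldl (\<oplus>) t ts) \<longleftrightarrow> is_term k t \<and> (\<forall>s\<in>set ts. is_term k s)"
  by (induction ts arbitrary: t) auto

lemma is_term_seq_mul:
  "is_term k x \<Longrightarrow> is_term k (seq_mul l (seq_single x) i)"
  by (induction l arbitrary: i) (auto simp: seq_plus_def is_term_foldl seq_single_def)

lemma is_term_D_term: "is_term k x \<Longrightarrow> is_term k (D_term d n x)"
  by (auto simp: D_term_def is_term_seq_mul split: prod.split)

lemma derivable_mono:
  assumes "derivable L T S" and ax: "\<And>S. S \<in> T \<Longrightarrow> derivable L T' S"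
  shows "derivable L T' S"
  using assms(1)
proof (induction rule: derivable.induct)
  case eq_refl
  show ?case by (rule derivable.eq_refl)
qed (auto intro: derivable.intros ax)

context
  fixes L :: logic and T :: "'i sequent set" and E :: "'i fm" and k :: nat
  assumes E: "is_formula L k E"
begin

lemma derivable_weaken:
  assumes "derivable L T (Top \<turnstile>\<^bsub>k\<^esub> \<phi>)"
  shows "derivable L T (E \<turnstile>\<^bsub>k\<^esub> \<phi>)"
  by (rule derivable.cut[OF derivable.top[OF E] assms])

lemma derivable_axiom_instance:
  assumes "(Top \<turnstile>\<^bsub>l\<^esub> Eq s t) \<in> T" "\<And>i. is_term k (\<rho> i)"
  shows "derivable L T (E \<turnstile>\<^bsub>k\<^esub> Eq (tsubst \<rho> s) (tsubst \<rho> t))"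
proof -
  have "derivable L T (fsubst \<rho> Top \<turnstile>\<^bsub>k\<^esub> fsubst \<rho> (Eq s t))"
    using assms by (intro derivable.subst[OF derivable.ax]) auto
  then show ?thesis by (intro derivable_weaken) simp
qed

lemma derivable_refl:
  assumes "is_term k t"
  shows "derivable L T (E \<turnstile>\<^bsub>k\<^esub> Eq t t)"
proof -
  have "derivable L T (fsubst (\<lambda>_. t) Top \<turnstile>\<^bsub>k\<^esub> fsubst (\<lambda>_. t) (Eq (Var 0) (Var 0)))"
    using assms by (intro derivable.subst[OF derivable.eq_refl]) auto
  then show ?thesis by (intro derivable_weaken) simp
qed

text \<open>
  Equal terms may be exchanged in an equation \<open>p = q\<close>, at the places marked by \<open>Var 0\<close>. The
  further variables are parameters; four in all suffice for the congruence laws below.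
\<close>
lemma derivable_replace:
  assumes \<sigma>: "\<And>i. is_term k (\<sigma> i)" and pq: "is_term 4 p" "is_term 4 q"
    and eq: "derivable L T (E \<turnstile>\<^bsub>k\<^esub> Eq (\<sigma> 0) (\<sigma> 1))"
    and inst: "derivable L T (E \<turnstile>\<^bsub>k\<^esub> Eq (tsubst \<sigma> p) (tsubst \<sigma> q))"
  shows "derivable L T (E \<turnstile>\<^bsub>k\<^esub> Eq (tsubst (\<sigma>(0 := \<sigma> 1)) p) (tsubst (\<sigma>(0 := \<sigma> 1)) q))"
proof -
  have "derivable L T (And (Eq (Var 0) (Var 1)) (Eq p q) \<turnstile>\<^bsub>4\<^esub> fsubst (Var(0 := Var 1)) (Eq p q))"
    using pq by (intro derivable.eq_replace) auto
  then have "derivable L T (fsubst \<sigma> (And (Eq (Var 0) (Var 1)) (Eq p q)) \<turnstile>\<^bsub>k\<^esub>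
      fsubst \<sigma> (fsubst (Var(0 := Var 1)) (Eq p q)))"
    using \<sigma> by (intro derivable.subst) auto
  moreover have "(\<lambda>i. tsubst \<sigma> ((Var(0 := Var 1)) i)) = \<sigma>(0 := \<sigma> 1)"
    by auto
  ultimately have "derivable L T (And (Eq (\<sigma> 0) (\<sigma> 1)) (Eq (tsubst \<sigma> p) (tsubst \<sigma> q)) \<turnstile>\<^bsub>k\<^esub>
      Eq (tsubst (\<sigma>(0 := \<sigma> 1)) p) (tsubst (\<sigma>(0 := \<sigma> 1)) q))"
    by (simp add: tsubst_tsubst)
  from derivable.cut[OF derivable.andI[OF eq inst] this] show ?thesis .
qed

lemma derivable_sym:
  assumes "is_term k s" "is_term k t" "derivable L T (E \<turnstile>\<^bsub>k\<^esub> Eq s t)"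
  shows "derivable L T (E \<turnstile>\<^bsub>k\<^esub> Eq t s)"
  using derivable_replace[of "(\<lambda>_. s)(1 := t)" "Var 0" "Var 2"] assms
  by (simp add: derivable_refl)

lemma derivable_trans:
  assumes "is_term k s" "is_term k t" "is_term k u"
    "derivable L T (E \<turnstile>\<^bsub>k\<^esub> Eq s t)" "derivable L T (E \<turnstile>\<^bsub>k\<^esub> Eq t u)"
  shows "derivable L T (E \<turnstile>\<^bsub>k\<^esub> Eq s u)"
  using derivable_replace[of "(\<lambda>_. u)(0 := t, 1 := s)" "Var 0" "Var 2"]
    derivable_sym[OF assms(1,2,4)] assms by simp

lemma derivable_Neg:
  assumes "is_term k s" "is_term k t" "derivable L T (E \<turnstile>\<^bsub>k\<^esub> Eq s t)"
  shows "derivable L T (E \<turnstile>\<^bsub>k\<^esub> Eq (Neg s) (Neg t))"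
  using derivable_replace[of "(\<lambda>_. s)(1 := t)" "Neg (Var 2)" "Neg (Var 0)"] assms
  by (simp add: derivable_refl)

lemma derivable_Oplus1:
  assumes "is_term k s" "is_term k t" "is_term k u" "derivable L T (E \<turnstile>\<^bsub>k\<^esub> Eq s t)"
  shows "derivable L T (E \<turnstile>\<^bsub>k\<^esub> Eq (s \<oplus> u) (t \<oplus> u))"
  using derivable_replace[of "(\<lambda>_. s)(1 := t, 3 := u)" "Var 2 \<oplus> Var 3" "Var 0 \<oplus> Var 3"] assms
  by (simp add: derivable_refl)

lemma derivable_Oplus2:
  assumes "is_term k s" "is_term k t" "is_term k u" "derivable L T (E \<turnstile>\<^bsub>k\<^esub> Eq s t)"
  shows "derivable L T (E \<turnstile>\<^bsub>k\<^esub> Eq (u \<oplus> s) (u \<oplus> t))"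
  using derivable_replace[of "(\<lambda>_. s)(1 := t, 3 := u)" "Var 3 \<oplus> Var 2" "Var 3 \<oplus> Var 0"] assms
  by (simp add: derivable_refl)

end

lemma derivable_Or_cases:
  assumes "is_formula L k E" "is_formula L k \<phi>" "is_formula L k \<psi>"
    and "derivable L T (E \<turnstile>\<^bsub>k\<^esub> Or \<phi> \<psi>)"
    and "derivable L T (And E \<phi> \<turnstile>\<^bsub>k\<^esub> \<chi>)" "derivable L T (And E \<psi> \<turnstile>\<^bsub>k\<^esub> \<chi>)"
  shows "derivable L T (E \<turnstile>\<^bsub>k\<^esub> \<chi>)"
proof -
  have "derivable L T (E \<turnstile>\<^bsub>k\<^esub> And E (Or \<phi> \<psi>))"
    using assms by (intro derivable.andI derivable.identity)
  moreover have "derivable L T (And E (Or \<phi> \<psi>) \<turnstile>\<^bsub>k\<^esub> Or (And E \<phi>) (And E \<psi>))"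
    using assms by (intro derivable.distrib)
  moreover have "derivable L T (Or (And E \<phi>) (And E \<psi>) \<turnstile>\<^bsub>k\<^esub> \<chi>)"
    using assms by (intro derivable.orE)
  ultimately show ?thesis by (blast intro: derivable.cut)
qed

text \<open>
  Each disjunction provable without premises splits the derivation in two. It is enough to treat
  the premises \<open>E'\<close> that decide all disjunctions of a finite list.
\<close>
lemma derivable_by_cases:
  assumes "is_formula L k E"
    and "\<And>x. x \<in> set xs \<Longrightarrow> is_formula L k (\<phi> x) \<and> is_formula L k (\<psi> x) \<and>
      derivable L T (Top \<turnstile>\<^bsub>k\<^esub> Or (\<phi> x) (\<psi> x))"
    and "\<And>E'. is_formula L k E' \<Longrightarrow> derivable L T (E' \<turnstile>\<^bsub>k\<^esub> E) \<Longrightarrow>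
      (\<And>x. x \<in> set xs \<Longrightarrow> derivable L T (E' \<turnstile>\<^bsub>k\<^esub> \<phi> x) \<or> derivable L T (E' \<turnstile>\<^bsub>k\<^esub> \<psi> x)) \<Longrightarrow>
      derivable L T (E' \<turnstile>\<^bsub>k\<^esub> \<chi>)"
  shows "derivable L T (E \<turnstile>\<^bsub>k\<^esub> \<chi>)"
  using assms
proof (induction xs arbitrary: E)
  case Nil
  then show ?case by (simp add: derivable.identity)
next
  case (Cons x xs)
  have x: "is_formula L k (\<phi> x)" "is_formula L k (\<psi> x)"
    "derivable L T (Top \<turnstile>\<^bsub>k\<^esub> Or (\<phi> x) (\<psi> x))"
    using Cons.prems(2) by auto
  have branch: "derivable L T (And E \<theta> \<turnstile>\<^bsub>k\<^esub> \<chi>)" if \<theta>: "\<theta> = \<phi> x \<or> \<theta> = \<psi> x" for \<theta>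
  proof (rule Cons.IH)
    have f: "is_formula L k \<theta>" using \<theta> x by auto
    then show "is_formula L k (And E \<theta>)" using Cons.prems(1) by simp
    show "is_formula L k (\<phi> y) \<and> is_formula L k (\<psi> y) \<and>
      derivable L T (Top \<turnstile>\<^bsub>k\<^esub> Or (\<phi> y) (\<psi> y))" if "y \<in> set xs" for y
      using Cons.prems(2)[of y] that by simp
    fix E'
    assume E': "is_formula L k E'" "derivable L T (E' \<turnstile>\<^bsub>k\<^esub> And E \<theta>)"
      and rest: "\<And>y. y \<in> set xs \<Longrightarrow> derivable L T (E' \<turnstile>\<^bsub>k\<^esub> \<phi> y) \<or> derivable L T (E' \<turnstile>\<^bsub>k\<^esub> \<psi> y)"
    show "derivable L T (E' \<turnstile>\<^bsub>k\<^esub> \<chi>)"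
    proof (rule Cons.prems(3)[OF E'(1)])
      show "derivable L T (E' \<turnstile>\<^bsub>k\<^esub> E)"
        by (rule derivable.cut[OF E'(2) derivable.and1[OF Cons.prems(1) f]])
      have "derivable L T (E' \<turnstile>\<^bsub>k\<^esub> \<theta>)"
        by (rule derivable.cut[OF E'(2) derivable.and2[OF Cons.prems(1) f]])
      then show "derivable L T (E' \<turnstile>\<^bsub>k\<^esub> \<phi> y) \<or> derivable L T (E' \<turnstile>\<^bsub>k\<^esub> \<psi> y)"
        if "y \<in> set (x # xs)" for y
        using that rest \<theta> by auto
    qed
  qed
  show ?case
    by (rule derivable_Or_cases[OF Cons.prems(1) x(1,2)])
      (auto intro: branch derivable_weaken x Cons.prems(1))
qed

lemma derivable_big_and_iff:
  assumes "is_formula L k E" "\<And>\<phi>. \<phi> \<in> set \<phi>s \<Longrightarrow> is_formula L k \<phi>"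
  shows "derivable L T (E \<turnstile>\<^bsub>k\<^esub> big_and \<phi>s) \<longleftrightarrow> (\<forall>\<phi>\<in>set \<phi>s. derivable L T (E \<turnstile>\<^bsub>k\<^esub> \<phi>))"
  using assms(2)
proof (induction \<phi>s)
  case Nil
  then show ?case using assms(1) by (simp add: derivable.top)
next
  case (Cons \<phi> \<phi>s)
  have f: "is_formula L k \<phi>" using Cons.prems by simp
  have fs: "is_formula L k (big_and \<phi>s)" using Cons.prems by (induction \<phi>s) auto
  have "derivable L T (E \<turnstile>\<^bsub>k\<^esub> And \<phi> (big_and \<phi>s)) \<longleftrightarrow>
      derivable L T (E \<turnstile>\<^bsub>k\<^esub> \<phi>) \<and> derivable L T (E \<turnstile>\<^bsub>k\<^esub> big_and \<phi>s)"
    using derivable.and1[OF f fs] derivable.and2[OF f fs]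
    by (blast intro: derivable.andI derivable.cut)
  then show ?case using Cons by simp
qed

lemma is_formula_big_or: "is_formula L k (big_or \<phi>s) \<longleftrightarrow> (\<forall>\<phi>\<in>set \<phi>s. is_formula L k \<phi>)"
  by (induction \<phi>s) auto

lemma is_formula_big_and: "is_formula L k (big_and \<phi>s) \<longleftrightarrow> (\<forall>\<phi>\<in>set \<phi>s. is_formula L k \<phi>)"
  by (induction \<phi>s) auto

lemma derivable_big_orI:
  assumes "\<And>\<phi>. \<phi> \<in> set \<phi>s \<Longrightarrow> is_formula L k \<phi>"
    and "\<phi> \<in> set \<phi>s" "derivable L T (E \<turnstile>\<^bsub>k\<^esub> \<phi>)"
  shows "derivable L T (E \<turnstile>\<^bsub>k\<^esub> big_or \<phi>s)"
  using assms
proof (induction \<phi>s)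
  case (Cons \<psi> \<phi>s)
  have "is_formula L k \<psi>" "is_formula L k (big_or \<phi>s)"
    using Cons.prems(1) by (auto simp: is_formula_big_or)
  then have "derivable L T (\<psi> \<turnstile>\<^bsub>k\<^esub> big_or (\<psi> # \<phi>s))"
    "derivable L T (big_or \<phi>s \<turnstile>\<^bsub>k\<^esub> big_or (\<psi> # \<phi>s))"
    by (auto intro: derivable.or1 derivable.or2)
  then show ?case using Cons by (auto intro: derivable.cut)
qed simp

lemma derivable_big_orE:
  assumes "is_formula L k \<chi>" "\<And>\<phi>. \<phi> \<in> set \<phi>s \<Longrightarrow> derivable L T (\<phi> \<turnstile>\<^bsub>k\<^esub> \<chi>)"
  shows "derivable L T (big_or \<phi>s \<turnstile>\<^bsub>k\<^esub> \<chi>)"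
  using assms by (induction \<phi>s) (auto intro: derivable.bot derivable.orE)

section \<open>The two theories\<close>

text \<open>
  All variables are identified with \<open>Var 0\<close>, so that the relation is a congruence on the whole
  type of terms and no condition on the context is needed.
\<close>
definition provably_equal :: "logic \<Rightarrow> 'i sequent set \<Rightarrow> 'i fm \<Rightarrow> mvterm \<Rightarrow> mvterm \<Rightarrow> bool" where
  "provably_equal L T E s t \<longleftrightarrow>
    derivable L T (E \<turnstile>\<^bsub>1\<^esub> Eq (tsubst (\<lambda>_. Var 0) s) (tsubst (\<lambda>_. Var 0) t))"

lemma is_term_collapse: "is_term 1 (tsubst (\<lambda>_. Var 0) t)"
  by (induction t) auto

lemma provably_equal_axiom:
  assumes "is_formula L 1 E" "(Top \<turnstile>\<^bsub>l\<^esub> Eq s t) \<in> T"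
  shows "provably_equal L T E (tsubst \<rho> s) (tsubst \<rho> t)"
  unfolding provably_equal_def tsubst_tsubst
  by (rule derivable_axiom_instance[OF assms]) (rule is_term_collapse)

lemma provably_equal_iff:
  assumes "is_term 1 s" "is_term 1 t"
  shows "provably_equal L T E s t \<longleftrightarrow> derivable L T (E \<turnstile>\<^bsub>1\<^esub> Eq s t)"
proof -
  have "tsubst (\<lambda>_. Var 0) t = t" if "is_term 1 t" for t
    using that by (rule tsubst_ident) simp
  then show ?thesis using assms by (simp add: provably_equal_def)
qed

lemma mv_congruence_provably_equal:
  assumes T: "MV_theory \<subseteq> T" and E: "is_formula L 1 E"
  shows "mv_congruence (provably_equal L T E)"
proof
  note collapse = is_term_collapse
  fix x y z x' y'
  show "provably_equal L T E x x"
    unfolding provably_equal_def by (rule derivable_refl[OF E collapse])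
  show "provably_equal L T E y x" if "provably_equal L T E x y"
    using that unfolding provably_equal_def by (rule derivable_sym[OF E collapse collapse])
  show "provably_equal L T E x z" if "provably_equal L T E x y" "provably_equal L T E y z"
    using that unfolding provably_equal_def by (rule derivable_trans[OF E collapse collapse collapse])
  show "provably_equal L T E (Neg x) (Neg y)" if "provably_equal L T E x y"
    using that unfolding provably_equal_def tsubst.simps by (rule derivable_Neg[OF E collapse collapse])
  show "provably_equal L T E (x \<oplus> y) (x' \<oplus> y')" if "provably_equal L T E x x'" "provably_equal L T E y y'"
  proof -
    have c: "is_term 1 (tsubst (\<lambda>_. Var 0) x \<oplus> tsubst (\<lambda>_. Var 0) y)" for x y
      using collapse by simp
    show ?thesis
      using that unfolding provably_equal_def tsubst.simps
      by (intro derivable_trans[OF E c c c derivable_Oplus1[OF E collapse collapse collapse]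
        derivable_Oplus2[OF E collapse collapse collapse]])
  qed
  let ?\<rho> = "\<lambda>i::nat. if i = 0 then x else if i = 1 then y else z"
  have inst: "provably_equal L T E (tsubst ?\<rho> s) (tsubst ?\<rho> t)" if "(l, s, t) \<in> mv_axioms" for l s t
    using that T by (intro provably_equal_axiom[OF E, of l]) (auto simp: MV_theory_def)
  show "provably_equal L T E ((x \<oplus> y) \<oplus> z) (x \<oplus> (y \<oplus> z))"
    using inst[of 3 "(Var 0 \<oplus> Var 1) \<oplus> Var 2" "Var 0 \<oplus> (Var 1 \<oplus> Var 2)"] by (simp add: mv_axioms_def Let_def)
  show "provably_equal L T E (x \<oplus> y) (y \<oplus> x)"
    using inst[of 2 "Var 0 \<oplus> Var 1" "Var 1 \<oplus> Var 0"] by (simp add: mv_axioms_def Let_def)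
  show "provably_equal L T E (x \<oplus> Zero) x"
    using inst[of 1 "Var 0 \<oplus> Zero" "Var 0"] by (simp add: mv_axioms_def Let_def)
  show "provably_equal L T E (Neg (Neg x)) x"
    using inst[of 1 "Neg (Neg (Var 0))" "Var 0"] by (simp add: mv_axioms_def Let_def)
  show "provably_equal L T E (x \<oplus> Neg Zero) (Neg Zero)"
    using inst[of 1 "Var 0 \<oplus> Neg Zero" "Neg Zero"] by (simp add: mv_axioms_def Let_def)
  show "provably_equal L T E (Neg (Neg x \<oplus> y) \<oplus> y) (Neg (Neg y \<oplus> x) \<oplus> x)"
    using inst[of 2 "Neg (Neg (Var 0) \<oplus> Var 1) \<oplus> Var 1" "Neg (Neg (Var 1) \<oplus> Var 0) \<oplus> Var 0"]
    by (simp add: mv_axioms_def Let_def)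
qed

text \<open>
  The Lindenbaum algebra of the hypothesis \<open>E\<close>: it satisfies every instance of the axioms, and
  what holds in it is what \<open>E\<close> proves.
\<close>
lemma generic_model:
  fixes T :: "'i sequent set"
  assumes K: "is_Komori_variety V I J" and T: "T_V I J \<subseteq> T" and E: "is_formula L 1 E"
  obtains le where "komori_order le I J"
    "\<And>t. is_term 1 t \<Longrightarrow> le One t \<longleftrightarrow> derivable L T (E \<turnstile>\<^bsub>1\<^esub> Eq t One)"
    "\<And>t. is_term 1 t \<Longrightarrow> derivable L T (E \<turnstile>\<^bsub>1\<^esub> Eq t Zero) \<Longrightarrow> le t Zero"
proof -
  have "MV_theory \<subseteq> T" using T by (auto simp: T_V_def Let_def)
  interpret C: mv_congruence "provably_equal L T E" by (rule mv_congruence_provably_equal[OF \<open>MV_theory \<subseteq> T\<close> E])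
  have inst: "C.le (tsubst (\<lambda>_. w) s) (tsubst (\<lambda>_. w) t)" if "((Top :: 'i fm) \<turnstile>\<^bsub>1\<^esub> Eq s t) \<in> T_V I J" for s t w
    using that T by (intro C.eq_imp_le provably_equal_axiom[OF E, of 1]) auto
  let ?N = "Max (I \<union> J)" and ?n = "komori_rank I J" and ?x = "Var 0"
  have "komori_identities C.le I J"
    unfolding komori_identities_def Let_def gap_identity_def
  proof (intro conjI allI impI)
    fix w
    show "C.le (tpow (tmul (?N + 1) (tpow w ?N)) 2) (tmul 2 (tpow w (?N + 1)))"
      using inst[of "tpow (tmul (?N + 1) (tpow ?x ?N)) 2" "tmul 2 (tpow ?x (?N + 1))" w]
      by (simp add: T_V_def Let_def del: tmul.simps tpow.simps)
    show "C.le (tpow (tmul (?n + 1) (tpow w ?n)) 2) (tmul 2 (tpow w (?n + 1)))"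
      using inst[of "tpow (tmul (?n + 1) (tpow ?x ?n)) 2" "tmul 2 (tpow ?x (?n + 1))" w]
      by (simp add: T_V_def Let_def del: tmul.simps tpow.simps)
    fix p
    assume p: "1 < p \<and> p < ?N \<and> (\<forall>m\<in>I \<union> J. \<not> p dvd m)"
    then have "((Top :: 'i fm) \<turnstile>\<^bsub>1\<^esub> Eq (tpow (tmul p (tpow ?x (p - 1))) (?N + 1)) (tmul (?N + 1) (tpow ?x p)))
        \<in> T_V I J"
      unfolding T_V_def Let_def by blast
    from inst[OF this, of w]
    show "C.le (tpow (tmul p (tpow w (p - 1))) (?N + 1)) (tmul (?N + 1) (tpow w p))"
      by (simp del: tmul.simps tpow.simps)
  qed
  then have "komori_order C.le I J"
    using K C.mv_order unfolding is_Komori_variety_def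
    by (intro komori_order.intro komori_order_axioms.intro) auto
  then show thesis
    by (rule that) (simp_all add: C.one_le_iff provably_equal_iff, simp add: C.eq_imp_le provably_equal_iff)
qed

lemma is_formula_Fin_fm: "is_term k x \<Longrightarrow> is_formula L k (Fin_fm d n x)"
  by (auto simp: Fin_fm_def Let_def rad_equiv_def is_formula_big_and is_term_D_term
      simp del: tmul.simps tpow.simps upt_Suc)

lemma is_term_Fin_terms: "is_term k x \<Longrightarrow> \<delta> \<in> set (Fin_terms d n x) \<Longrightarrow> is_term k \<delta>"
  by (auto simp: Fin_terms_def Let_def is_term_D_term
      simp del: tmul.simps tpow.simps upt_Suc split: if_splits)

lemma derivable_Fin_fm_iff:
  fixes E :: "'i fm"
  assumes E: "is_formula L k E" and x: "is_term k x"
  shows "derivable L T (E \<turnstile>\<^bsub>k\<^esub> Fin_fm d n x) \<longleftrightarrow>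
    (\<forall>\<delta>\<in>set (Fin_terms d n x). derivable L T (E \<turnstile>\<^bsub>k\<^esub> Eq (rad_term n \<delta>) Zero))"
proof (cases "d = 0")
  case True
  then show ?thesis by (simp add: Fin_fm_def Fin_terms_def rad_term_def)
next
  case False
  then have Fin: "(Fin_fm d n x :: 'i fm) =
      big_and (map (\<lambda>\<delta>. Eq (rad_term n \<delta>) Zero) (Fin_terms d n x))"
    by (simp add: Fin_fm_def Fin_terms_def rad_equiv_def rad_term_def Let_def comp_def
        del: tmul.simps tpow.simps upt_Suc)
  have "is_term k (rad_term n \<delta>)" if "\<delta> \<in> set (Fin_terms d n x)" for \<delta>
    using is_term_Fin_terms[OF x that] by (simp add: rad_term_def del: tmul.simps tpow.simps)
  then show ?thesis unfolding Fin by (subst derivable_big_and_iff[OF E]) auto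
qed

text \<open>
  The cases are decided by \<open>\<sigma>\<^sub>n\<close> at the terms of all \<open>Fin\<^sub>d\<close>. In an inconsistent branch
  \<open>0 = 1\<close> is derivable; in the others a point of the generic model selects \<open>d\<close>.
\<close>
lemma rho_from_sigma:
  fixes T :: "'i sequent set"
  assumes K: "is_Komori_variety V I J" and T: "Loc1 I J \<subseteq> T"
  shows "derivable L T (rho_seq (komori_rank I J))"
proof -
  define n where "n = komori_rank I J"
  define ts where "ts = concat (map (\<lambda>d. Fin_terms d n (Var 0)) [0..<n + 1])"
  have ts: "\<delta> \<in> set ts \<longleftrightarrow> (\<exists>d\<le>n. \<delta> \<in> set (Fin_terms d n (Var 0)))" for \<delta>
    by (auto simp: ts_def less_Suc_eq_le simp del: upt_Suc)
  have sub: "T_V I J \<subseteq> T" "sigma_seq n \<in> T" "nontriviality \<in> T"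
    using T by (auto simp: Loc1_def n_def)
  let ?small = "\<lambda>\<delta>. Eq (rad_term n \<delta>) Zero :: 'i fm"
    and ?big = "\<lambda>\<delta>. Eq (tmul (n + 1) \<delta>) One :: 'i fm"
    and ?rho = "big_or (map (\<lambda>d. Fin_fm d n (Var 0)) [0..<n + 1]) :: 'i fm"
  have rho: "is_formula L 1 ?rho"
    by (auto simp: is_formula_big_or is_formula_Fin_fm simp del: upt_Suc)
  have "derivable L T (Top \<turnstile>\<^bsub>1\<^esub> ?rho)"
  proof (rule derivable_by_cases[where xs = ts and \<phi> = ?small and \<psi> = ?big])
    show "is_formula L 1 (Top :: 'i fm)" by simp
    fix \<delta> assume "\<delta> \<in> set ts"
    then have \<delta>: "is_term 1 \<delta>" using ts is_term_Fin_terms[of 1 "Var 0"] by auto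
    have "derivable L T (fsubst (\<lambda>_. \<delta>) Top \<turnstile>\<^bsub>1\<^esub> fsubst (\<lambda>_. \<delta>) (Or (?small (Var 0)) (?big (Var 0))))"
      using sub(2) \<delta> unfolding sigma_seq_def rad_term_def by (intro derivable.subst derivable.ax) auto
    then show "is_formula L 1 (?small \<delta>) \<and> is_formula L 1 (?big \<delta>) \<and>
        derivable L T (Top \<turnstile>\<^bsub>1\<^esub> Or (?small \<delta>) (?big \<delta>))"
      using \<delta> by (simp add: rad_term_def del: tmul.simps tpow.simps)
  next
    fix E :: "'i fm"
    assume E: "is_formula L 1 E"
      and cases: "\<And>\<delta>. \<delta> \<in> set ts \<Longrightarrow>
        derivable L T (E \<turnstile>\<^bsub>1\<^esub> ?small \<delta>) \<or> derivable L T (E \<turnstile>\<^bsub>1\<^esub> ?big \<delta>)"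
    obtain le where "komori_order le I J"
      and one: "\<And>t. is_term 1 t \<Longrightarrow> le One t \<longleftrightarrow> derivable L T (E \<turnstile>\<^bsub>1\<^esub> Eq t One)"
      using generic_model[OF K sub(1) E] by metis
    interpret A: komori_order le I J by fact
    show "derivable L T (E \<turnstile>\<^bsub>1\<^esub> ?rho)"
    proof (cases "le One Zero")
      case True
      then have "derivable L T (E \<turnstile>\<^bsub>1\<^esub> Eq Zero One)" using one[of Zero] by simp
      moreover have "derivable L T (fsubst Var (Eq Zero One) \<turnstile>\<^bsub>1\<^esub> fsubst Var Bot)"
        using sub(3) unfolding nontriviality_def by (intro derivable.subst derivable.ax) auto
      then have "derivable L T (Eq Zero One \<turnstile>\<^bsub>1\<^esub> Bot)" by simp
      ultimately show ?thesis by (blast intro: derivable.cut derivable.bot rho)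
    next
      case False
      then obtain d where d: "d \<le> n"
        and nbig: "\<And>\<delta>. \<delta> \<in> set (Fin_terms d n (Var 0)) \<Longrightarrow> \<not> le One (tmul (n + 1) \<delta>)"
        using A.fin_exists[of "Var 0"] unfolding n_def by blast
      have "derivable L T (E \<turnstile>\<^bsub>1\<^esub> ?small \<delta>)" if \<delta>: "\<delta> \<in> set (Fin_terms d n (Var 0))" for \<delta>
        using cases[of \<delta>] nbig[OF \<delta>] one[of "tmul (n + 1) \<delta>"] \<delta> d is_term_Fin_terms[OF _ \<delta>, of 1] ts
        by (auto simp del: tmul.simps)
      then have "derivable L T (E \<turnstile>\<^bsub>1\<^esub> Fin_fm d n (Var 0))"
        by (subst derivable_Fin_fm_iff[OF E]) simp_all
      then show ?thesis
        using d by (intro derivable_big_orI) (auto simp: is_formula_Fin_fm simp del: upt_Suc)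
    qed
  qed
  then show ?thesis by (simp only: rho_seq_def n_def)
qed

text \<open>
  Each disjunct of \<open>\<rho>\<^sub>n\<close> proves one disjunct of \<open>\<sigma>\<^sub>n\<close>: the first for \<open>d = 0\<close>, and the
  second, checked in the generic model of the disjunct, for \<open>d \<ge> 1\<close>.
\<close>
lemma sigma_from_rho:
  fixes T :: "'i sequent set"
  assumes K: "is_Komori_variety V I J" and T: "Loc2 I J \<subseteq> T"
  shows "derivable L T (sigma_seq (komori_rank I J))"
proof -
  define n where "n = komori_rank I J"
  have sub: "T_V I J \<subseteq> T" "rho_seq n \<in> T"
    using T by (auto simp: Loc2_def n_def)
  let ?small = "Eq (rad_term n (Var 0)) Zero :: 'i fm"
    and ?big = "Eq (tmul (n + 1) (Var 0)) One :: 'i fm"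
  have f: "is_formula L 1 ?small" "is_formula L 1 ?big"
    by (simp_all add: rad_term_def del: tmul.simps tpow.simps)
  have "derivable L T (Fin_fm d n (Var 0) \<turnstile>\<^bsub>1\<^esub> Or ?small ?big)" if d: "d \<le> n" for d
  proof (cases "d = 0")
    case True
    then show ?thesis using derivable.or1[OF f] by (simp add: Fin_fm_def rad_term_def)
  next
    case False
    let ?E = "Fin_fm d n (Var 0) :: 'i fm"
    have E: "is_formula L 1 ?E" by (simp add: is_formula_Fin_fm)
    obtain le where "komori_order le I J"
      and one: "\<And>t. is_term 1 t \<Longrightarrow> le One t \<longleftrightarrow> derivable L T (?E \<turnstile>\<^bsub>1\<^esub> Eq t One)"
      and zero: "\<And>t. is_term 1 t \<Longrightarrow> derivable L T (?E \<turnstile>\<^bsub>1\<^esub> Eq t Zero) \<Longrightarrow> le t Zero"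
      using generic_model[OF K sub(1) E] by metis
    interpret A: komori_order le I J by fact
    have "le (rad_term n \<delta>) Zero" if \<delta>: "\<delta> \<in> set (Fin_terms d n (Var 0))" for \<delta>
    proof (rule zero)
      show "is_term 1 (rad_term n \<delta>)"
        using is_term_Fin_terms[OF _ \<delta>, of 1] by (simp add: rad_term_def del: tmul.simps tpow.simps)
      show "derivable L T (?E \<turnstile>\<^bsub>1\<^esub> Eq (rad_term n \<delta>) Zero)"
        using derivable.identity[OF E] derivable_Fin_fm_iff[OF E, of "Var 0"] \<delta> by simp
    qed
    then have "le One (tmul (n + 1) (Var 0))"
      using A.fin_imp_large[of d "Var 0"] False d unfolding n_def by blast
    then have "derivable L T (?E \<turnstile>\<^bsub>1\<^esub> ?big)" using one[of "tmul (n + 1) (Var 0)"] by simp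
    then show ?thesis by (rule derivable.cut[OF _ derivable.or2[OF f]])
  qed
  then have "derivable L T (big_or (map (\<lambda>d. Fin_fm d n (Var 0)) [0..<n + 1]) \<turnstile>\<^bsub>1\<^esub> Or ?small ?big)"
    using f by (intro derivable_big_orE) auto
  with derivable.ax[OF sub(2)] show ?thesis
    unfolding rho_seq_def sigma_seq_def rad_term_def n_def by (rule derivable.cut)
qed

theorem mainTheorem8:
  fixes V :: "'a mv_struct set" and I J :: "nat set"
    and L :: logic and S :: "'i sequent"
  assumes "is_Komori_variety V I J"
  shows "derivable L (Loc1 I J) S \<longleftrightarrow> derivable L (Loc2 I J) S"
proof
  have 1: "derivable L (Loc1 I J) S'" if "S' \<in> Loc2 I J" for S' :: "'i sequent"
    using that rho_from_sigma[OF assms order_refl, of L]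
    by (auto simp: Loc1_def Loc2_def intro: derivable.ax)
  have 2: "derivable L (Loc2 I J) S'" if "S' \<in> Loc1 I J" for S' :: "'i sequent"
    using that sigma_from_rho[OF assms order_refl, of L]
    by (auto simp: Loc1_def Loc2_def intro: derivable.ax)
  show "derivable L (Loc1 I J) S \<Longrightarrow> derivable L (Loc2 I J) S"
    by (rule derivable_mono[OF _ 2])
  show "derivable L (Loc2 I J) S \<Longrightarrow> derivable L (Loc1 I J) S"
    by (rule derivable_mono[OF _ 1])
qed

end
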